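(* Let $p$ be an odd prime, $\epsilon_0\in\{1,-1\}$, and $n,s$ non-negative integers with $s\ge1$ if $p=3$. If $n=4+s$, there exists a $p$-ary pure quantum code with parameters $[[\frac{p^{n-1}-\epsilon_0p^{n-3}}{2},\,\frac{p^{n-1}-\epsilon_0p^{n-3}}{2}-n-2,\,3]]_p$, which is at least almost optimal according to the quantum Hamming bound. If $n=3+s$, there exists a $p$-ary pure quantum code with parameters $[[\frac{p^{n-1}+\epsilon_0p^{n-2}}{2},\,\frac{p^{n-1}+\epsilon_0p^{n-2}}{2}-n-2,\,3]]_p$, which is at least almost optimal according to the quantum Hamming bound.
   Context: A $p$-ary $[[N,K,d]]_p$ quantum code is a $p^K$-dimensional subspace $Q$ of $\mathbb{C}^{p^N}$ with minimum distance $d$; it is pure if $\langle v_1|E|v_2\rangle=0$ for all $v_1,v_2\in Q$ and every error operator $E$ of quantum weight between $1$ and $d-1$. The quantum Hamming bound for a pure $[[N,K,d]]_p$ code is $p^{N-K}\ge\sum_{j=0}^{\lfloor(d-1)/2\rfloor}\binom{N}{j}(p^2-1)^j$. An $[[N,K,d]]_p$ code is optimal if no $[[N,K,d+1]]_p$ code exists, almost optimal if an optimal $[[N,K,d+1]]_p$ code exists; "at least almost optimal according to the quantum Hamming bound" means the quantum Hamming bound certifies it is optimal or almost optimal for its length and dimension. *)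

theory Defs
  imports Complex_Main "HOL-Computational_Algebra.Primes" "HOL-Library.FuncSet" "HOL-Library.Function_Algebras"
begin

text \<open>The Hilbert space C^(p^N) of N qudits of dimension p: complex functions on the
  computational basis {0..<N} ->E {0..<p}, vanishing outside it.\<close>

type_synonym qstate = "(nat \<Rightarrow> nat) \<Rightarrow> complex"

definition basis_set :: "nat \<Rightarrow> nat \<Rightarrow> (nat \<Rightarrow> nat) set" where
  "basis_set p N = {0..<N} \<rightarrow>\<^sub>E {0..<p}"

definition hilbert_space :: "nat \<Rightarrow> nat \<Rightarrow> qstate set" where
  "hilbert_space p N = {v. \<forall>x. x \<notin> basis_set p N \<longrightarrow> v x = 0}"

definition cscale :: "complex \<Rightarrow> qstate \<Rightarrow> qstate" where
  "cscale c v = (\<lambda>x. c * v x)"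

definition qinner :: "nat \<Rightarrow> nat \<Rightarrow> qstate \<Rightarrow> qstate \<Rightarrow> complex" where
  "qinner p N u v = (\<Sum>x\<in>basis_set p N. cnj (u x) * v x)"

text \<open>Error basis X(a)Z(b), a,b in F_p^N: X(a)Z(b)|y> = omega^(b.y) |y+a>, omega = exp(2 pi i/p).\<close>

definition pauli :: "nat \<Rightarrow> nat \<Rightarrow> (nat \<Rightarrow> nat) \<Rightarrow> (nat \<Rightarrow> nat) \<Rightarrow> qstate \<Rightarrow> qstate" where
  "pauli p N a b v = (\<lambda>x. if x \<in> basis_set p N then
      (let y = restrict (\<lambda>i. (x i + p - a i) mod p) {0..<N} in
        cis (2 * pi / real p) ^ (\<Sum>i<N. b i * y i) * v y)
    else 0)"

definition error_set :: "nat \<Rightarrow> nat \<Rightarrow> ((nat \<Rightarrow> nat) \<times> (nat \<Rightarrow> nat)) set" where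
  "error_set p N = basis_set p N \<times> basis_set p N"

definition qweight :: "nat \<Rightarrow> (nat \<Rightarrow> nat) \<Rightarrow> (nat \<Rightarrow> nat) \<Rightarrow> nat" where
  "qweight N a b = card {i\<in>{0..<N}. a i \<noteq> 0 \<or> b i \<noteq> 0}"

definition is_qcode :: "nat \<Rightarrow> nat \<Rightarrow> nat \<Rightarrow> qstate set \<Rightarrow> bool" where
  "is_qcode p N K Q \<longleftrightarrow> Q \<subseteq> hilbert_space p N \<and> module.subspace cscale Q
     \<and> vector_space.dim cscale Q = p ^ K"

definition detects :: "nat \<Rightarrow> nat \<Rightarrow> qstate set \<Rightarrow> (nat \<Rightarrow> nat) \<Rightarrow> (nat \<Rightarrow> nat) \<Rightarrow> bool" where
  "detects p N Q a b \<longleftrightarrow>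
     (\<exists>c. \<forall>u\<in>Q. \<forall>v\<in>Q. qinner p N u (pauli p N a b v) = c * qinner p N u v)"

definition min_distance :: "nat \<Rightarrow> nat \<Rightarrow> qstate set \<Rightarrow> nat \<Rightarrow> bool" where
  "min_distance p N Q d \<longleftrightarrow> 1 \<le> d \<and>
     (\<forall>(a,b)\<in>error_set p N. qweight N a b < d \<longrightarrow> detects p N Q a b) \<and>
     (\<exists>(a,b)\<in>error_set p N. qweight N a b = d \<and> \<not> detects p N Q a b)"

definition is_pure :: "nat \<Rightarrow> nat \<Rightarrow> qstate set \<Rightarrow> nat \<Rightarrow> bool" where
  "is_pure p N Q d \<longleftrightarrow>
     (\<forall>(a,b)\<in>error_set p N. 1 \<le> qweight N a b \<and> qweight N a b \<le> d - 1 \<longrightarrow>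
        (\<forall>u\<in>Q. \<forall>v\<in>Q. qinner p N u (pauli p N a b v) = 0))"

definition pure_qcode :: "nat \<Rightarrow> nat \<Rightarrow> nat \<Rightarrow> nat \<Rightarrow> qstate set \<Rightarrow> bool" where
  "pure_qcode p N K d Q \<longleftrightarrow> is_qcode p N K Q \<and> min_distance p N Q d \<and> is_pure p N Q d"

definition quantum_hamming_bound :: "nat \<Rightarrow> nat \<Rightarrow> nat \<Rightarrow> nat \<Rightarrow> bool" where
  "quantum_hamming_bound p N K d \<longleftrightarrow>
     K \<le> N \<and> p ^ (N - K) \<ge> (\<Sum>j\<le>(d - 1) div 2. (N choose j) * (p\<^sup>2 - 1) ^ j)"

text \<open>The quantum Hamming bound certifies that an [[N,K,d]]_p code is optimal or almost
  optimal: it rules out (pure) [[N,K,d+2]]_p codes, hence all [[N,K,d']]_p with d' >= d+2.\<close>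
definition at_least_almost_optimal_QHB :: "nat \<Rightarrow> nat \<Rightarrow> nat \<Rightarrow> nat \<Rightarrow> bool" where
  "at_least_almost_optimal_QHB p N K d \<longleftrightarrow> \<not> quantum_hamming_bound p N K (d + 2)"

end

theory Submission
  imports Defs "HOL-Number_Theory.Cong"
begin

text \<open>
  The code is the joint fixed space of a group of Pauli operators without phases, generated by
  \<open>n + 2\<close> rows \<open>(X, Z)\<close> of length \<open>N\<close> over the field with \<open>p\<close> elements. To position \<open>i < N\<close> belong the
  two columns \<open>(1, 0, v)\<close> and \<open>(0, 1, M v)\<close>, where \<open>v\<close> is the vector of the \<open>n\<close> base-\<open>p\<close> digits of
  \<open>i\<close> and \<open>M\<close> is a matrix without eigenvalues. Then the columns of any two positions are linearly
  independent, since otherwise the difference of their vectors would be an eigenvector of \<open>M\<close>;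
  this is purity up to weight 2. The entries of each row are affine functions of the digits, and
  both lengths are multiples of \<open>p\<close>, and of 9 if \<open>p = 3\<close>. Hence the lowest digit, or the lowest two
  digits, run through complete residue systems, over which polynomials of degree at most 2 sum to
  zero, so that the rows are orthogonal. The dimension of the code is the number of orbits of
  basis states under the translations in the group.
\<close>

section \<open>Pauli operators\<close>

interpretation qstate: vector_space cscale
  by unfold_locales (auto simp: cscale_def fun_eq_iff algebra_simps)

locale qudits =
  fixes p N :: nat
  assumes prime: "prime p"
begin

abbreviation B where "B \<equiv> basis_set p N"

text \<open>Vectors over the prime field are handled as integer-valued functions, so that
  differences are not truncated; \<open>red\<close> returns to the canonical labels in
  \<open>B\<close>.\<close>

definition red :: "(nat \<Rightarrow> int) \<Rightarrow> nat \<Rightarrow> nat" where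
  "red f = restrict (\<lambda>i. nat (f i mod int p)) {0..<N}"

definition add where "add x y = red (\<lambda>i. int (x i) + int (y i))"
definition sub where "sub x y = red (\<lambda>i. int (x i) - int (y i))"
definition zero where "zero = red (\<lambda>_. 0)"
definition dot :: "(nat \<Rightarrow> nat) \<Rightarrow> (nat \<Rightarrow> nat) \<Rightarrow> int" where
  "dot x y = (\<Sum>i<N. int (x i) * int (y i))"
text \<open>The additive character modulo \<open>p\<close>, taken on all integers so that
  conjugation is negation of the argument.\<close>

definition chi :: "int \<Rightarrow> complex" where
  "chi z = cis (2 * pi * real_of_int z / real p)"

lemma p_pos: "p > 0" and p_gt_1: "p > 1"
  using prime prime_gt_0_nat prime_gt_1_nat by auto

lemma finite_B [simp]: "finite B"
  by (auto simp: basis_set_def intro: finite_PiE)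

lemma card_B: "card B = p ^ N"
  by (simp add: basis_set_def card_PiE)

lemma red_in_B [simp]: "red f \<in> B"
  using p_pos by (auto simp: red_def basis_set_def nat_less_iff)

lemma add_in_B [simp]: "add x y \<in> B"
  and sub_in_B [simp]: "sub x y \<in> B"
  and zero_in_B [simp]: "zero \<in> B"
  by (simp_all add: add_def sub_def zero_def)

lemma cong_red: "i < N \<Longrightarrow> [int (red f i) = f i] (mod int p)"
  using p_pos by (simp add: red_def cong_def)

lemma red_cong: "(\<And>i. i < N \<Longrightarrow> [f i = g i] (mod int p)) \<Longrightarrow> red f = red g"
  by (auto simp: red_def cong_def intro!: restrict_ext)

lemma red_of_nat: "x \<in> B \<Longrightarrow> red (\<lambda>i. int (x i)) = x"
  by (rule ext) (auto simp: red_def basis_set_def PiE_iff extensional_def simp flip: of_nat_mod)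

lemma B_eqI:
  assumes "x \<in> B" "y \<in> B" "\<And>i. i < N \<Longrightarrow> [int (x i) = int (y i)] (mod int p)"
  shows "x = y"
proof -
  have "red (\<lambda>i. int (x i)) = red (\<lambda>i. int (y i))"
    by (rule red_cong[OF assms(3)])
  with assms(1,2) show ?thesis by (simp add: red_of_nat)
qed

lemma zero_eq: "i < N \<Longrightarrow> zero i = 0"
  by (simp add: zero_def red_def)

lemma sub_red_left: "sub (red f) y = red (\<lambda>i. f i - int (y i))"
  and sub_red_right: "sub x (red f) = red (\<lambda>i. int (x i) - f i)"
  and add_red_left: "add (red f) y = red (\<lambda>i. f i + int (y i))"
  and add_red_right: "add x (red f) = red (\<lambda>i. int (x i) + f i)"
  unfolding sub_def add_def
  by (rule red_cong, intro cong_diff Cong.cong_add cong_red cong_refl, assumption)+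

lemmas red_simps = sub_red_left sub_red_right add_red_left add_red_right

lemma sub_sub_comm: "sub (sub x a) b = sub (sub x b) a"
  unfolding sub_def[of x] red_simps by (simp add: algebra_simps)

lemma sub_self: "sub x x = zero"
  by (simp add: sub_def zero_def)

lemma sub_red_red: "sub (red f) (red g) = red (\<lambda>i. f i - g i)"
  unfolding sub_def by (rule red_cong, intro cong_diff cong_red)

lemma sub_sub_sub: "sub (sub x z) (sub x y) = sub y z"
  unfolding sub_def[of x] sub_red_red by (simp add: sub_def)

lemma sub_zero_sub: "sub x (sub zero y) = add x y"
  unfolding zero_def red_simps add_def by (simp add: algebra_simps)

lemma add_commute: "add x y = add y x"
  by (simp add: add_def add.commute)

lemma sub_zero: "x \<in> B \<Longrightarrow> sub x zero = x"
  by (simp add: zero_def red_simps red_of_nat)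

lemma add_zero: "x \<in> B \<Longrightarrow> add x zero = x"
  by (simp add: zero_def red_simps red_of_nat)

lemma sub_add_cancel: "x \<in> B \<Longrightarrow> sub (add x y) y = x"
  unfolding add_def red_simps by (simp add: red_of_nat)

lemma add_sub_cancel: "x \<in> B \<Longrightarrow> add (sub x y) y = x"
  unfolding sub_def red_simps by (simp add: red_of_nat)

lemma bij_sub: "bij_betw (\<lambda>x. sub x a) B B"
  by (rule bij_betwI[where g = "\<lambda>x. add x a"]) (auto simp: sub_add_cancel add_sub_cancel)

lemma dot_red: "[dot b (red f) = (\<Sum>i<N. int (b i) * f i)] (mod int p)"
  unfolding dot_def by (intro cong_sum cong_mult cong_refl cong_red) auto

lemma dot_red_red: "[dot (red g) (red f) = (\<Sum>i<N. g i * f i)] (mod int p)"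
  unfolding dot_def by (intro cong_sum cong_mult cong_refl cong_red) auto

lemma dot_commute: "dot a b = dot b a"
  by (simp add: dot_def mult.commute)

lemma dot_sub: "[dot b (sub x a) = dot b x - dot b a] (mod int p)"
proof -
  have "[dot b (sub x a) = (\<Sum>i<N. int (b i) * (int (x i) - int (a i)))] (mod int p)"
    unfolding sub_def by (rule dot_red)
  then show ?thesis by (simp add: dot_def algebra_simps sum_subtractf)
qed

lemma dot_sub_left: "[dot (sub x a) b = dot x b - dot a b] (mod int p)"
  using dot_sub[of b x a] by (simp add: dot_commute)

lemma dot_add: "[dot b (add x a) = dot b x + dot b a] (mod int p)"
proof -
  have "[dot b (add x a) = (\<Sum>i<N. int (b i) * (int (x i) + int (a i)))] (mod int p)"
    unfolding add_def by (rule dot_red)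
  then show ?thesis by (simp add: dot_def algebra_simps sum.distrib)
qed

lemma dot_zero [simp]: "dot zero b = 0" "dot b zero = 0"
  by (auto simp: dot_def zero_eq intro!: sum.neutral)

section \<open>Additive characters\<close>

lemma chi_add: "chi (x + y) = chi x * chi y"
  by (simp add: chi_def cis_mult ring_distribs add_divide_distrib)

lemma chi_0 [simp]: "chi 0 = 1"
  by (simp add: chi_def)

lemma cnj_chi: "cnj (chi x) = chi (- x)"
  by (simp add: chi_def cis_cnj)

lemma chi_eq_1_iff: "chi z = 1 \<longleftrightarrow> int p dvd z"
proof
  assume "int p dvd z"
  then obtain k where "z = int p * k" by auto
  then show "chi z = 1"
    using p_pos cis_multiple_2pi[of "real_of_int k"] by (simp add: chi_def mult.assoc)
next
  assume "chi z = 1"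
  then have "cos (2 * pi * real_of_int z / real p) = 1"
    by (metis chi_def cis.sel(1) one_complex.sel(1))
  then obtain k :: int where "2 * pi * real_of_int z / real p = of_int k * 2 * pi"
    by (auto simp: cos_one_2pi_int)
  then have "real_of_int z = of_int (k * int p)"
    using p_pos by (simp add: field_simps)
  then show "int p dvd z" by (metis dvd_triv_right of_int_eq_iff)
qed

lemma chi_cong:
  assumes "[x = y] (mod int p)" shows "chi x = chi y"
proof -
  have "chi (x - y) = 1" using assms by (simp add: chi_eq_1_iff cong_iff_dvd_diff)
  then show ?thesis using chi_add[of "x - y" y] by simp
qed

section \<open>Action and commutation of Pauli operators\<close>

lemma pauli_eq:
  assumes "a \<in> B"
  shows "pauli p N a b v x = (if x \<in> B then chi (dot b (sub x a)) * v (sub x a) else 0)"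
proof (cases "x \<in> B")
  case True
  have r: "restrict (\<lambda>i. (x i + p - a i) mod p) {0..<N} = sub x a"
  proof
    fix i
    show "restrict (\<lambda>i. (x i + p - a i) mod p) {0..<N} i = sub x a i"
    proof (cases "i < N")
      case True
      with assms have "a i < p" by (auto simp: basis_set_def PiE_iff)
      then have "int ((x i + p - a i) mod p) = (int (x i) - int (a i)) mod int p"
        using mod_add_self1[of "int p" "int (x i) - int (a i)"]
        by (simp add: zmod_int of_nat_diff algebra_simps)
      with True show ?thesis by (simp add: sub_def red_def)
    qed (simp add: sub_def red_def)
  qed
  have "cis (2 * pi / real p) ^ (\<Sum>i<N. b i * sub x a i) = chi (dot b (sub x a))"
    by (simp add: chi_def dot_def DeMoivre algebra_simps)
  with True show ?thesis by (simp add: pauli_def r Let_def)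
qed (simp add: pauli_def)

lemma pauli_in_hilbert [simp]: "pauli p N a b v \<in> hilbert_space p N"
  by (simp add: hilbert_space_def pauli_def)

lemma pauli_cscale: "pauli p N a b (cscale c v) = cscale c (pauli p N a b v)"
  by (auto simp: pauli_def cscale_def Let_def)

lemma pauli_add: "pauli p N a b (v + w) = pauli p N a b v + pauli p N a b w"
  by (auto simp: pauli_def Let_def algebra_simps)

lemma pauli_zero_zero: "v \<in> hilbert_space p N \<Longrightarrow> pauli p N zero zero v = v"
  by (rule ext) (auto simp: pauli_eq sub_zero hilbert_space_def)

text \<open>Both orders translate by \<open>a + a'\<close>; they differ only in phase, and the
  exponents collected on the two sides differ by the symplectic form of the two errors.\<close>

lemma pauli_commute:
  assumes "a \<in> B" "a' \<in> B"
  shows "pauli p N a b (pauli p N a' b' v) =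
    cscale (chi (dot b a' - dot b' a)) (pauli p N a' b' (pauli p N a b v))"
proof
  fix x
  show "pauli p N a b (pauli p N a' b' v) x =
    cscale (chi (dot b a' - dot b' a)) (pauli p N a' b' (pauli p N a b v)) x"
  proof (cases "x \<in> B")
    case True
    have l: "[dot b (sub x a) + dot b' (sub (sub x a) a') =
        (dot b x - dot b a) + (dot b' x - dot b' a - dot b' a')] (mod int p)"
      by (intro Cong.cong_add dot_sub cong_trans[OF dot_sub] cong_diff cong_refl)
    have r: "[dot b a' - dot b' a + (dot b' (sub x a') + dot b (sub (sub x a') a)) =
        dot b a' - dot b' a + ((dot b' x - dot b' a') + (dot b x - dot b a' - dot b a))] (mod int p)"
      by (intro Cong.cong_add dot_sub cong_trans[OF dot_sub] cong_diff cong_refl)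
    have "[dot b (sub x a) + dot b' (sub (sub x a) a') =
        dot b a' - dot b' a + (dot b' (sub x a') + dot b (sub (sub x a') a))] (mod int p)"
      using l r by (simp add: cong_def algebra_simps)
    from chi_cong[OF this] True assms show ?thesis
      by (simp add: pauli_eq cscale_def sub_sub_comm chi_add)
  qed (simp add: pauli_eq assms cscale_def)
qed

text \<open>Translation permutes \<open>B\<close>, and the phases cancel against their
  conjugates.\<close>

lemma qinner_pauli:
  assumes "a \<in> B"
  shows "qinner p N (pauli p N a b u) (pauli p N a b v) = qinner p N u v"
proof -
  have "qinner p N (pauli p N a b u) (pauli p N a b v)
      = (\<Sum>x\<in>B. (\<lambda>y. cnj (u y) * v y) (sub x a))"
    unfolding qinner_def
    by (intro sum.cong refl) (use chi_add[of "- dot b (sub x a)" "dot b (sub x a)" for x] in \<open>simp add: pauli_eq assms cnj_chi\<close>)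
  also have "\<dots> = qinner p N u v"
    unfolding qinner_def by (rule sum.reindex_bij_betw[OF bij_sub])
  finally show ?thesis .
qed

lemma qinner_cscale: "qinner p N u (cscale c v) = c * qinner p N u v"
  by (simp add: qinner_def cscale_def sum_distrib_left algebra_simps)

lemma qinner_diff: "qinner p N u (v - w) = qinner p N u v - qinner p N u w"
  by (simp add: qinner_def sum_subtractf algebra_simps)

lemma qinner_self_eq_0:
  assumes "v \<in> hilbert_space p N" "qinner p N v v = 0"
  shows "v = 0"
proof -
  have "qinner p N v v = of_real (\<Sum>x\<in>B. (cmod (v x))\<^sup>2)"
    unfolding qinner_def of_real_sum
    by (intro sum.cong refl) (simp add: complex_norm_square[symmetric] mult.commute)
  with assms(2) have "(\<Sum>x\<in>B. (cmod (v x))\<^sup>2) = 0" by (metis of_real_eq_0_iff)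
  then have "\<forall>x\<in>B. v x = 0" by (subst (asm) sum_nonneg_eq_0_iff) auto
  with assms(1) show ?thesis by (auto simp: hilbert_space_def fun_eq_iff)
qed

text \<open>Shifting the summation variable by a \<open>y\<close> with \<open>dot b y\<close>
  nonzero modulo \<open>p\<close> multiplies the sum by a number other than 1.\<close>

lemma sum_chi_dot:
  assumes "b \<in> B" "b \<noteq> zero"
  shows "(\<Sum>x\<in>B. chi (dot b x)) = 0"
proof -
  obtain j where j: "j < N" "\<not> int p dvd int (b j)"
    using B_eqI[OF assms(1) zero_in_B] assms(2) by (auto simp: zero_eq cong_0_iff cong_int_iff)
  define y where "y = red (\<lambda>i. if i = j then 1 else 0)"
  have "[dot b y = int (b j)] (mod int p)"
    using dot_red[of b "\<lambda>i. if i = j then 1 else 0"] j by (simp add: y_def if_distrib cong: if_cong)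
  then have y: "\<not> int p dvd dot b y" using j cong_dvd_iff by blast
  have "(\<Sum>x\<in>B. chi (dot b x)) = (\<Sum>x\<in>B. (\<lambda>x. chi (dot b x)) (sub x y))"
    by (rule sum.reindex_bij_betw[OF bij_sub, symmetric])
  also have "\<dots> = (\<Sum>x\<in>B. chi (- dot b y) * chi (dot b x))"
    by (intro sum.cong refl) (simp add: chi_cong[OF dot_sub] chi_add[symmetric])
  finally have "(1 - chi (- dot b y)) * (\<Sum>x\<in>B. chi (dot b x)) = 0"
    by (simp add: sum_distrib_left[symmetric] left_diff_distrib)
  moreover have "chi (- dot b y) \<noteq> 1" using y by (simp add: chi_eq_1_iff)
  ultimately show ?thesis by simp
qed

end

section \<open>Stabilizer codes\<close>

text \<open>\<open>dot_G\<close> is stronger than commutation, which only needs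
  \<open>dot b a' - dot b' a\<close> to vanish modulo \<open>p\<close>. With \<open>dot b a'\<close>
  itself zero, products of the operators \<open>X(a)Z(b)\<close> pick up no phase, so they form a
  group as they stand.\<close>

locale stabilizer_group = qudits +
  fixes G :: "((nat \<Rightarrow> nat) \<times> (nat \<Rightarrow> nat)) set"
  assumes G_subset: "G \<subseteq> B \<times> B"
    and zero_G: "(zero, zero) \<in> G"
    and sub_G: "(a, b) \<in> G \<Longrightarrow> (a', b') \<in> G \<Longrightarrow> (sub a a', sub b b') \<in> G"
    and dot_G: "(a, b) \<in> G \<Longrightarrow> (a', b') \<in> G \<Longrightarrow> int p dvd dot b a'"
begin

definition code :: "qstate set" where
  "code = {v \<in> hilbert_space p N. \<forall>(a, b) \<in> G. pauli p N a b v = v}"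

text \<open>\<open>A\<close> is the group of translations and \<open>H\<close> the kernel of the
  projection from \<open>G\<close> to \<open>A\<close>. Code states live only on \<open>P\<close>,
  where all phases from \<open>H\<close> are trivial, and \<open>R\<close> has one label for each
  orbit of \<open>A\<close> in \<open>P\<close>.\<close>

definition A where "A = fst ` G"
definition H where "H = {b. (zero, b) \<in> G}"
definition P where "P = {x \<in> B. \<forall>b \<in> H. int p dvd dot b x}"
text \<open>On \<open>B\<close> the predicate depends on \<open>x\<close> only through its coset
  modulo \<open>A\<close>, so the choice is constant on orbits.\<close>

definition rep where "rep x = (SOME y. y \<in> B \<and> sub x y \<in> A)"
definition R where "R = rep ` P"
definition sect where "sect a = (SOME b. (a, b) \<in> G)"

text \<open>For \<open>r\<close> in \<open>P\<close> the amplitude at \<open>r\<close> is 1, and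
  invariance under a lift of \<open>sub x r\<close> forces the phase at \<open>x\<close>.\<close>

definition orbit_state :: "(nat \<Rightarrow> nat) \<Rightarrow> qstate" where
  "orbit_state r x = (if x \<in> B \<and> sub x r \<in> A then chi (dot (sect (sub x r)) r) else 0)"

lemma G_in_B: "(a, b) \<in> G \<Longrightarrow> a \<in> B" "(a, b) \<in> G \<Longrightarrow> b \<in> B"
  using G_subset by auto

lemma add_G: "(a, b) \<in> G \<Longrightarrow> (a', b') \<in> G \<Longrightarrow> (add a a', add b b') \<in> G"
  using sub_G[of a b "sub zero a'" "sub zero b'"] sub_G[OF zero_G, of a' b']
  by (simp add: sub_zero_sub)

lemma zero_A: "zero \<in> A" and A_subset: "A \<subseteq> B"
  using imageI[OF zero_G, of fst] G_subset by (auto simp: A_def)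

lemma sub_A: "a \<in> A \<Longrightarrow> a' \<in> A \<Longrightarrow> sub a a' \<in> A"
  by (metis (no_types, lifting) A_def fst_conv image_iff sub_G surj_pair)

lemma add_A: "a \<in> A \<Longrightarrow> a' \<in> A \<Longrightarrow> add a a' \<in> A"
  using sub_A[OF _ sub_A[OF zero_A]] by (simp add: sub_zero_sub)

lemma sect: "a \<in> A \<Longrightarrow> (a, sect a) \<in> G"
proof -
  assume "a \<in> A"
  then obtain b where "(a, b) \<in> G" by (auto simp: A_def)
  then show "(a, sect a) \<in> G" unfolding sect_def by (rule someI[of "\<lambda>b. (a, b) \<in> G"])
qed

lemma zero_H: "zero \<in> H" and H_subset: "H \<subseteq> B"
  using zero_G G_in_B by (auto simp: H_def)

lemma sub_H: "(a, b) \<in> G \<Longrightarrow> (a, b') \<in> G \<Longrightarrow> sub b b' \<in> H"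
  using sub_G[of a b a b'] by (simp add: H_def sub_self)

lemma add_H: "h \<in> H \<Longrightarrow> h' \<in> H \<Longrightarrow> add h h' \<in> H"
  using add_G[of zero h zero h'] by (simp add: H_def add_zero)

section \<open>Counting orbits\<close>

text \<open>The lifts of a translation \<open>a\<close> form exactly one coset of \<open>H\<close>,
  the one through \<open>sect a\<close>.\<close>

lemma card_A_H: "card A * card H = card G"
proof -
  have "bij_betw (\<lambda>(a, h). (a, add h (sect a))) (A \<times> H) G"
  proof (rule bij_betwI[where g = "\<lambda>(a, b). (a, sub b (sect a))"])
    show "(\<lambda>(a, h). (a, add h (sect a))) \<in> A \<times> H \<rightarrow> G"
    proof clarsimp
      fix a h assume "a \<in> A" "h \<in> H"
      then show "(a, add h (sect a)) \<in> G"
        using add_G[of zero h a "sect a"] sect A_subset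
        by (auto simp: H_def add_commute[of zero] add_zero subset_iff)
    qed
    show "(\<lambda>(a, b). (a, sub b (sect a))) \<in> G \<rightarrow> A \<times> H"
    proof clarsimp
      fix a b assume ab: "(a, b) \<in> G"
      then have "a \<in> A" by (force simp: A_def)
      with ab show "a \<in> A \<and> sub b (sect a) \<in> H" using sect sub_H by blast
    qed
  qed (use H_subset G_in_B in \<open>auto simp: sub_add_cancel add_sub_cancel subset_iff\<close>)
  from bij_betw_same_card[OF this] show ?thesis by (simp add: card_cartesian_product)
qed

text \<open>Both sides count the character sum of \<open>chi (dot b x)\<close> over \<open>B \<times> H\<close>.\<close>

lemma card_P_H: "card P * card H = p ^ N"
proof -
  have fin: "finite H" using finite_subset[OF H_subset] by simp
  have P: "P \<subseteq> B" by (auto simp: P_def)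
  have 1: "(\<Sum>b\<in>H. chi (dot b x)) = (if x \<in> P then of_nat (card H) else 0)" if "x \<in> B" for x
  proof (cases "x \<in> P")
    case True
    then have "\<forall>b\<in>H. chi (dot b x) = 1" by (auto simp: P_def chi_eq_1_iff)
    with True show ?thesis by simp
  next
    case False
    then obtain c where c: "c \<in> H" "\<not> int p dvd dot c x" using \<open>x \<in> B\<close> by (auto simp: P_def)
    \<comment> \<open>Translating \<open>H\<close> by \<open>c\<close> multiplies the sum by
      \<open>chi (- dot c x)\<close>, which is not 1.\<close>
    have "bij_betw (\<lambda>b. sub b c) H H"
    proof (rule bij_betwI[where g = "\<lambda>b. add b c"])
      show "(\<lambda>b. sub b c) \<in> H \<rightarrow> H" "(\<lambda>b. add b c) \<in> H \<rightarrow> H"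
        using sub_H[OF _ \<open>c \<in> H\<close>[unfolded H_def mem_Collect_eq]] add_H[OF _ c(1)]
        by (simp_all add: H_def)
    qed (use H_subset in \<open>auto simp: sub_add_cancel add_sub_cancel subset_iff\<close>)
    then have "(\<Sum>b\<in>H. chi (dot b x)) = (\<Sum>b\<in>H. (\<lambda>b. chi (dot b x)) (sub b c))"
      by (rule sum.reindex_bij_betw[symmetric])
    also have "\<dots> = (\<Sum>b\<in>H. chi (- dot c x) * chi (dot b x))"
      by (intro sum.cong refl) (simp add: chi_cong[OF dot_sub_left] chi_add[symmetric])
    finally have "(1 - chi (- dot c x)) * (\<Sum>b\<in>H. chi (dot b x)) = 0"
      by (simp add: sum_distrib_left[symmetric] left_diff_distrib)
    moreover have "chi (- dot c x) \<noteq> 1" using c by (simp add: chi_eq_1_iff)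
    ultimately show ?thesis using False by simp
  qed
  have 2: "(\<Sum>x\<in>B. chi (dot b x)) = (if b = zero then of_nat (p ^ N) else 0)" if "b \<in> H" for b
    using that H_subset sum_chi_dot[of b] by (auto simp: card_B)
  have "of_nat (card P * card H) = (\<Sum>x\<in>B. if x \<in> P then of_nat (card H) else (0::complex))"
    using P by (simp add: sum.If_cases Int_absorb1)
  also have "\<dots> = (\<Sum>x\<in>B. \<Sum>b\<in>H. chi (dot b x))" by (simp add: 1)
  also have "\<dots> = (\<Sum>b\<in>H. \<Sum>x\<in>B. chi (dot b x))" by (rule sum.swap)
  also have "\<dots> = (\<Sum>b\<in>H. if b = zero then of_nat (p ^ N) else 0)" by (simp add: 2)
  also have "\<dots> = of_nat (p ^ N)" using fin zero_H by simp
  finally show ?thesis by (simp only: of_nat_eq_iff)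
qed

text \<open>By \<open>dot_G\<close> every element of \<open>H\<close> pairs to zero with every
  translation in \<open>A\<close>, so \<open>P\<close> is a union of orbits.\<close>

lemma add_P: "x \<in> P \<Longrightarrow> a \<in> A \<Longrightarrow> add x a \<in> P"
proof -
  assume x: "x \<in> P" and a: "a \<in> A"
  have "int p dvd dot b (add x a)" if "b \<in> H" for b
  proof -
    have "int p dvd dot b x + dot b a"
      using x sect[OF a] dot_G that by (auto simp: P_def H_def)
    then show ?thesis using cong_dvd_iff[OF dot_add] by blast
  qed
  then show ?thesis by (simp add: P_def)
qed

lemma rep: "x \<in> B \<Longrightarrow> rep x \<in> B \<and> sub x (rep x) \<in> A"
  unfolding rep_def by (rule someI[of _ x]) (simp add: sub_self zero_A)

lemma sub_A_trans:
  assumes "sub x y \<in> A" "sub x z \<in> A" shows "sub y z \<in> A"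
proof -
  from sub_A[OF assms(2,1)] show ?thesis by (simp add: sub_sub_sub)
qed

lemma sub_A_sym: "x \<in> B \<Longrightarrow> sub x y \<in> A \<Longrightarrow> sub y x \<in> A"
  by (rule sub_A_trans[of x]) (auto simp: sub_self zero_A)

lemma rep_eq:
  assumes "x \<in> B" "y \<in> B" "sub x y \<in> A" shows "rep x = rep y"
proof -
  have "(\<lambda>z. z \<in> B \<and> sub x z \<in> A) = (\<lambda>z. z \<in> B \<and> sub y z \<in> A)"
    using assms sub_A_trans sub_A_sym by blast
  then show ?thesis by (simp add: rep_def)
qed

lemma R_subset: "R \<subseteq> P"
proof
  fix r assume "r \<in> R"
  then obtain x where x: "x \<in> P" "r = rep x" by (auto simp: R_def)
  then have "x \<in> B" by (auto simp: P_def)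
  with x rep sub_A_sym have "r \<in> B" "sub r x \<in> A" by auto
  then show "r \<in> P"
    using add_P[OF x(1), of "sub r x"] by (simp add: add_commute[of x] add_sub_cancel)
qed

lemma P_subset: "P \<subseteq> B" by (auto simp: P_def)

lemma rep_R: "r \<in> R \<Longrightarrow> rep r = r"
proof -
  assume "r \<in> R"
  then obtain x where x: "x \<in> B" "r = rep x" using P_subset by (auto simp: R_def)
  with rep[OF x(1)] rep_eq[of x r] show "rep r = r" by simp
qed

lemma R_unique: "r \<in> R \<Longrightarrow> r' \<in> R \<Longrightarrow> sub r r' \<in> A \<Longrightarrow> r = r'"
  using rep_eq[of r r'] rep_R R_subset P_subset by (auto simp: subset_iff)

lemma card_R_A: "card R * card A = card P"
proof -
  have "bij_betw (\<lambda>(r, a). add r a) (R \<times> A) P"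
  proof (rule bij_betwI[where g = "\<lambda>x. (rep x, sub x (rep x))"])
    show "(\<lambda>(r, a). add r a) \<in> R \<times> A \<rightarrow> P"
      using add_P R_subset by auto
    show "(\<lambda>x. (rep x, sub x (rep x))) \<in> P \<rightarrow> R \<times> A"
      using rep P_subset by (auto simp: R_def)
    show "(\<lambda>(r, a). add r a) ((\<lambda>x. (rep x, sub x (rep x))) x) = x" if "x \<in> P" for x
      using that P_subset by (simp add: add_commute[of "rep x"] add_sub_cancel subset_iff)
    fix z assume z: "z \<in> R \<times> A"
    obtain r a where ra: "z = (r, a)" "r \<in> R" "a \<in> A" using z by auto
    then have B: "r \<in> B" "a \<in> B" using R_subset P_subset A_subset by auto
    have s: "sub (add r a) r = a" using B by (simp add: add_commute[of r] sub_add_cancel)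
    then have "rep (add r a) = r" using rep_eq[of "add r a" r] rep_R ra B by simp
    then show "(\<lambda>x. (rep x, sub x (rep x))) ((\<lambda>(r, a). add r a) z) = z"
      using s ra by simp
  qed
  from bij_betw_same_card[OF this] show ?thesis by (simp add: card_cartesian_product)
qed

text \<open>The individual sizes of \<open>A\<close>, \<open>H\<close> and \<open>P\<close> drop
  out; only the order of the group matters for the dimension.\<close>

lemma card_R: "card R * card G = p ^ N"
  by (metis card_A_H card_P_H card_R_A mult.assoc)

section \<open>A basis of the code\<close>

lemma code_fixed: "v \<in> code \<Longrightarrow> (a, b) \<in> G \<Longrightarrow> pauli p N a b v = v"
  by (auto simp: code_def)

text \<open>The group element that translates \<open>r\<close> to \<open>x\<close> fixes
  \<open>v\<close>; evaluating this at \<open>x\<close> ties the two amplitudes together.\<close>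

lemma code_shift:
  assumes "v \<in> code" "r \<in> B" "x \<in> B" "(sub x r, b) \<in> G"
  shows "v x = chi (dot b r) * v r"
proof -
  have s: "sub x (sub x r) = r"
    using assms(2) by (intro B_eqI) (auto simp: sub_def[of x r] sub_red_right intro: cong_trans[OF cong_red])
  have "v x = pauli p N (sub x r) b v x" by (simp add: code_fixed[OF assms(1,4)])
  then show ?thesis using assms by (simp add: pauli_eq s)
qed

text \<open>Some element of \<open>H\<close> has a nontrivial phase at such an \<open>x\<close> in
  \<open>B\<close>, and it multiplies \<open>v x\<close> by that phase.\<close>

lemma code_outside_P:
  assumes "v \<in> code" "x \<notin> P" shows "v x = 0"
proof (cases "x \<in> B")
  case True
  then obtain b where b: "(zero, b) \<in> G" "\<not> int p dvd dot b x"
    using assms(2) by (auto simp: P_def H_def)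
  have "v x = chi (dot b x) * v x"
    using code_shift[OF assms(1) True True, of b] b by (simp add: sub_self)
  then show ?thesis using b by (auto simp: chi_eq_1_iff)
qed (use assms in \<open>auto simp: code_def hilbert_space_def\<close>)

text \<open>The lifts chosen by \<open>sect\<close> need not be additive, but the defect lies in
  \<open>H\<close> and is invisible on \<open>P\<close>.\<close>

lemma orbit_state_in_code:
  assumes "r \<in> R" shows "orbit_state r \<in> code"
proof -
  have r: "r \<in> P" "r \<in> B" using assms R_subset P_subset by auto
  have "pauli p N a b (orbit_state r) x = orbit_state r x" if ab: "(a, b) \<in> G" for a b x
  proof (cases "x \<in> B")
    case True
    have "a \<in> B" "a \<in> A" using ab G_in_B(1) imageI[OF ab, of fst] by (auto simp: A_def)
    have iff: "sub (sub x a) r \<in> A \<longleftrightarrow> sub x r \<in> A"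
      using sub_A[OF _ \<open>a \<in> A\<close>, of "sub x r"] add_A[OF _ \<open>a \<in> A\<close>, of "sub (sub x r) a"]
      by (auto simp: sub_sub_comm[of x a r] add_sub_cancel)
    show ?thesis
    proof (cases "sub x r \<in> A")
      case A: True
      let ?c = "sect (sub (sub x a) r)" and ?d = "sect (sub x r)"
      have c: "(sub (sub x r) a, ?c) \<in> G" and d: "(sub x r, ?d) \<in> G"
        using sect[of "sub (sub x a) r"] sect A iff by (auto simp: sub_sub_comm[of x a r])
      \<comment> \<open>A second lift of \<open>sub x r\<close> besides \<open>?d\<close>; the two
        differ by an element of \<open>H\<close>, which pairs to zero with \<open>r\<close>.\<close>
      have "(sub x r, add ?c b) \<in> G"
        using add_G[OF c ab] by (simp add: add_sub_cancel)
      then have "sub (add ?c b) ?d \<in> H" using sub_H d by blast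
      then have "int p dvd dot (sub (add ?c b) ?d) r" using r by (auto simp: P_def)
      moreover have "[dot (sub (add ?c b) ?d) r = (dot ?c r + dot b r) - dot ?d r] (mod int p)"
        using dot_add[of r ?c b]
        by (intro cong_trans[OF dot_sub_left] cong_diff) (simp_all add: dot_commute)
      ultimately have 1: "int p dvd (dot ?c r + dot b r) - dot ?d r"
        using cong_dvd_iff by blast
      have 2: "int p dvd dot b (sub x a) - (dot b x - dot b a)" "int p dvd dot b a"
          "int p dvd dot b (sub x r) - (dot b x - dot b r)" "int p dvd dot b (sub x r)"
        using dot_sub[of b x] dot_G ab d by (auto simp: cong_iff_dvd_diff)
      \<comment> \<open>The phase difference is written as a sum of multiples of \<open>p\<close>:
        the deviations from \<open>dot_sub\<close>, two terms killed by \<open>dot_G\<close>, and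
        the \<open>H\<close> term of fact \<open>1\<close>.\<close>
      have "dot b (sub x a) + dot ?c r - dot ?d r
          = (dot b (sub x a) - (dot b x - dot b a)) - dot b a
            - (dot b (sub x r) - (dot b x - dot b r)) + dot b (sub x r)
            + ((dot ?c r + dot b r) - dot ?d r)" by simp
      also have "int p dvd \<dots>" by (intro dvd_add dvd_diff 1 2)
      finally have "[dot b (sub x a) + dot ?c r = dot ?d r] (mod int p)"
        by (simp only: cong_iff_dvd_diff)
      from chi_cong[OF this] show ?thesis using A iff True \<open>a \<in> B\<close>
        by (simp add: pauli_eq orbit_state_def chi_add)
    qed (use iff True \<open>a \<in> B\<close> in \<open>simp add: pauli_eq orbit_state_def\<close>)
  qed (use G_in_B[OF ab] in \<open>simp add: pauli_eq orbit_state_def\<close>)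
  then show ?thesis by (auto simp: code_def hilbert_space_def orbit_state_def)
qed

text \<open>Distinct representatives have disjoint orbits, so evaluation on \<open>R\<close> reads
  off coefficients. This yields both injectivity and linear independence.\<close>

lemma orbit_state_R:
  assumes "r \<in> R" "r' \<in> R"
  shows "orbit_state r r' = (if r' = r then 1 else 0)"
proof (cases "r' = r")
  case True
  have "sect zero \<in> H" using sect[OF zero_A] by (simp add: H_def)
  moreover have "r \<in> P" "r \<in> B" using assms R_subset P_subset by auto
  ultimately show ?thesis using True zero_A
    by (auto simp: orbit_state_def sub_self P_def chi_eq_1_iff)
next
  case False
  with assms R_unique show ?thesis by (auto simp: orbit_state_def)
qed

lemma code_expansion:
  assumes "v \<in> code"
  shows "v x = (\<Sum>r\<in>R. v r * orbit_state r x)"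
proof (cases "x \<in> P")
  case True
  have fin: "finite R" using R_subset P_subset finite_subset finite_B by metis
  have x: "x \<in> B" using True P_subset by auto
  define r where "r = rep x"
  have r: "r \<in> R" "r \<in> B" "sub x r \<in> A" using True x rep by (auto simp: r_def R_def)
  have "orbit_state r' x = 0" if "r' \<in> R" "r' \<noteq> r" for r'
    using R_unique[OF that(1) r(1)] sub_A_trans[of x r' r] r(3) that(2)
    by (auto simp: orbit_state_def)
  then have "(\<Sum>r\<in>R. v r * orbit_state r x) = (\<Sum>r'\<in>{r}. v r' * orbit_state r' x)"
    using fin r by (intro sum.mono_neutral_right) auto
  also have "\<dots> = v x"
    using r x code_shift[OF assms r(2) x sect[OF r(3)]] by (simp add: orbit_state_def)
  finally show ?thesis by simp
next
  case False
  have "orbit_state r x = 0" if "r \<in> R" for r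
    by (rule code_outside_P[OF orbit_state_in_code[OF that] False])
  with code_outside_P[OF assms False] show ?thesis by simp
qed

lemma subspace_code: "qstate.subspace code"
proof (rule qstate.subspaceI)
  have "pauli p N a b 0 = 0" for a b by (simp add: pauli_def fun_eq_iff Let_def)
  then show "0 \<in> code" by (simp add: code_def hilbert_space_def case_prod_unfold)
next
  fix u v assume "u \<in> code" "v \<in> code"
  then show "u + v \<in> code" by (fastforce simp: code_def hilbert_space_def pauli_add)
next
  fix c v assume "v \<in> code"
  then have "cscale c v \<in> hilbert_space p N" "pauli p N a b (cscale c v) = cscale c v"
    if "(a, b) \<in> G" for a b
    using that by (auto simp: code_def hilbert_space_def pauli_cscale) (simp add: cscale_def)
  then show "cscale c v \<in> code" using zero_G by (auto simp: code_def)
qed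

lemma is_qcode_code:
  assumes "card G = p ^ m"
  shows "m \<le> N" "is_qcode p N (N - m) code"
proof -
  have c: "card R * p ^ m = p ^ N" using card_R assms by simp
  \<comment> \<open>The order of the group divides \<open>p ^ N\<close>; having
    \<open>m \<le> N\<close> first makes the truncated subtraction \<open>N - m\<close>
    exact.\<close>
  then have "p ^ m dvd p ^ N" by (metis dvd_triv_right)
  then show m: "m \<le> N" using p_gt_1 power_dvd_imp_le by blast
  then have "card R * p ^ m = p ^ (N - m) * p ^ m" using c by (simp flip: power_add)
  then have cR: "card R = p ^ (N - m)" using p_pos by simp
  have fin: "finite R" using R_subset P_subset finite_subset finite_B by metis
  have inj: "inj_on orbit_state R"
    by (rule inj_onI) (metis orbit_state_R zero_neq_one)
  have sum_apply: "(\<Sum>v\<in>orbit_state ` R. cscale (u v) v) x = (\<Sum>r\<in>R. u (orbit_state r) * orbit_state r x)"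
    for u x
  proof -
    have "(\<Sum>v\<in>S. cscale (u v) v) x = (\<Sum>v\<in>S. u v * v x)" if "finite S" for S
      using that by induction (auto simp: cscale_def)
    from this[of "orbit_state ` R"] show ?thesis using fin inj by (simp add: sum.reindex)
  qed
  have ind: "qstate.independent (orbit_state ` R)"
  proof (rule qstate.independent_if_scalars_zero)
    fix f v assume 0: "(\<Sum>v\<in>orbit_state ` R. cscale (f v) v) = 0" and "v \<in> orbit_state ` R"
    then obtain r where r: "r \<in> R" "v = orbit_state r" by auto
    have "0 = (\<Sum>s\<in>R. f (orbit_state s) * orbit_state s r)"
      using sum_apply[of f r] 0 by simp
    also have "\<dots> = (\<Sum>s\<in>R. if r = s then f (orbit_state s) else 0)"
      using r by (intro sum.cong) (auto simp: orbit_state_R)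
    finally show "f v = 0" using r fin by simp
  qed (use fin in simp)
  have span: "code \<subseteq> qstate.span (orbit_state ` R)"
  proof
    fix v assume v: "v \<in> code"
    have "v = (\<Sum>s\<in>orbit_state ` R. cscale (v (the_inv_into R orbit_state s)) s)"
      by (rule ext, rule trans[OF code_expansion[OF v]])
        (simp add: sum_apply the_inv_into_f_f[OF inj] cong: sum.cong)
    then show "v \<in> qstate.span (orbit_state ` R)"
      by (subst \<open>v = _\<close>) (intro qstate.span_sum qstate.span_scale qstate.span_base)
  qed
  have "qstate.dim code = p ^ (N - m)"
    using qstate.dim_unique[OF _ span ind] orbit_state_in_code card_image[OF inj] cR by auto
  then show "is_qcode p N (N - m) code"
    using subspace_code by (auto simp: is_qcode_def code_def)
qed

section \<open>Detection and minimum distance\<close>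

lemma code_nonzero:
  obtains v where "v \<in> code" "v \<noteq> 0"
proof -
  have "card R \<noteq> 0" using card_R p_pos by (intro notI) simp
  then obtain r where r: "r \<in> R" by (metis card.empty ex_in_conv)
  then have "orbit_state r \<noteq> 0" using orbit_state_R[of r r] by (intro notI) simp
  with r orbit_state_in_code that show ?thesis by blast
qed

text \<open>Applying a stabilizer element to both arguments preserves the inner product by
  unitarity, yet moving it past the error produces a phase other than 1.\<close>

lemma qinner_code_eq_0:
  assumes "(a, b) \<in> G" "a' \<in> B" "\<not> int p dvd dot b a' - dot b' a" "u \<in> code" "v \<in> code"
  shows "qinner p N u (pauli p N a' b' v) = 0"
proof -
  let ?g = "pauli p N a b" and ?e = "pauli p N a' b'"
  have a: "a \<in> B" using assms(1) G_in_B by blast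
  have g: "?g u = u" "?g v = v" using assms by (auto simp: code_def)
  have "qinner p N u (?e v) = qinner p N (?g u) (?g (?e v))"
    by (rule qinner_pauli[OF a, symmetric])
  also have "\<dots> = chi (dot b a' - dot b' a) * qinner p N u (?e v)"
    by (simp add: pauli_commute[OF a assms(2)] qinner_cscale g)
  finally show ?thesis using assms(3) by (auto simp: chi_eq_1_iff)
qed

definition commutes where
  "commutes a' b' \<longleftrightarrow> (\<forall>(a, b) \<in> G. int p dvd dot b a' - dot b' a)"

lemma pauli_code:
  assumes "a' \<in> B" "commutes a' b'" "v \<in> code"
  shows "pauli p N a' b' v \<in> code"
proof -
  have "pauli p N a b (pauli p N a' b' v) = pauli p N a' b' v" if ab: "(a, b) \<in> G" for a b
  proof -
    have "int p dvd dot b a' - dot b' a" "pauli p N a b v = v"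
      using assms ab by (auto simp: commutes_def code_def)
    moreover from this(1) have "chi (dot b a' - dot b' a) = 1" by (simp only: chi_eq_1_iff)
    ultimately show ?thesis
      using pauli_commute[OF G_in_B(1)[OF ab] assms(1), of b b' v]
      by (simp add: cscale_def)
  qed
  then show ?thesis by (auto simp: code_def)
qed

text \<open>An error commuting with the stabilizer acts on the code as a scalar if it is detected,
  which is impossible as soon as it fails to commute with another such error.\<close>

lemma not_detects:
  assumes "a \<in> B" "commutes a b" "a' \<in> B" "commutes a' b'" "\<not> int p dvd dot b a' - dot b' a"
  shows "\<not> detects p N code a b"
proof
  let ?e = "pauli p N a b" and ?f = "pauli p N a' b'"
  assume "detects p N code a b"
  then obtain c where c: "\<And>u v. u \<in> code \<Longrightarrow> v \<in> code \<Longrightarrow> qinner p N u (?e v) = c * qinner p N u v"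
    unfolding detects_def by blast
  have e: "?e v = cscale c v" if v: "v \<in> code" for v
  proof -
    \<comment> \<open>The part of \<open>?e v\<close> beyond the scalar multiple lies in the code
      and is orthogonal to all of it, hence to itself.\<close>
    let ?w = "?e v - cscale c v"
    have w: "?w \<in> code"
      using v pauli_code[OF assms(1,2)] subspace_code
      by (intro qstate.subspace_diff qstate.subspace_scale) auto
    have "qinner p N ?w ?w = 0"
      by (simp add: qinner_diff[of ?w] qinner_cscale c[OF w v])
    moreover have "?w \<in> hilbert_space p N" using w by (simp add: code_def)
    ultimately have "?w = 0" by (rule qinner_self_eq_0[rotated])
    then show ?thesis by simp
  qed
  obtain v where v: "v \<in> code" "v \<noteq> 0" by (rule code_nonzero)
  have nz: "qinner p N v v \<noteq> 0" using v qinner_self_eq_0[of v] by (auto simp: code_def)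
  have "c \<noteq> 0"
    using qinner_pauli[OF assms(1), of b v v] nz by (auto simp: e v qinner_cscale)
  have fv: "?f v \<in> code" using pauli_code assms v by blast
  have "cscale c (?f v) = ?e (?f v)" using e fv by simp
  also have "\<dots> = cscale (chi (dot b a' - dot b' a)) (?f (?e v))"
    by (rule pauli_commute[OF assms(1,3)])
  also have "\<dots> = cscale (chi (dot b a' - dot b' a)) (cscale c (?f v))"
    by (simp add: e v pauli_cscale)
  finally have "(1 - chi (dot b a' - dot b' a)) * (c * ?f v x) = 0" for x
    by (auto simp: cscale_def fun_eq_iff algebra_simps)
  then have "?f v = 0" using \<open>c \<noteq> 0\<close> assms(5) by (auto simp: fun_eq_iff chi_eq_1_iff)
  then have "qinner p N v v = 0"
    using qinner_pauli[OF assms(3), of b' v v] by (simp add: qinner_def)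
  with nz show False by simp
qed

text \<open>\<open>small\<close> gives purity and detection below weight \<open>d\<close>.
  \<open>large\<close> exhibits an undetectable error of weight \<open>d\<close>, so the distance is
  exactly \<open>d\<close> and not merely at least \<open>d\<close>.\<close>

lemma pure_qcode_code:
  assumes card: "card G = p ^ m"
    and small: "\<And>a b. a \<in> B \<Longrightarrow> b \<in> B \<Longrightarrow> 1 \<le> qweight N a b \<Longrightarrow> qweight N a b < d \<Longrightarrow> \<not> commutes a b"
    and large: "a \<in> B" "b \<in> B" "qweight N a b = d" "commutes a b"
      "a' \<in> B" "commutes a' b'" "\<not> int p dvd dot b a' - dot b' a"
    and d: "d \<ge> 1"
  shows "pure_qcode p N (N - m) d code"
proof -
  have z: "qinner p N u (pauli p N a b v) = 0"
    if "a \<in> B" "b \<in> B" "1 \<le> qweight N a b" "qweight N a b < d" "u \<in> code" "v \<in> code" for a b u v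
    using small[OF that(1-4)] qinner_code_eq_0 that unfolding commutes_def by blast
  have "is_pure p N code d"
    unfolding is_pure_def error_set_def using d by (auto intro!: z)
  moreover have "detects p N code a b" if "a \<in> B" "b \<in> B" "qweight N a b < d" for a b
  proof (cases "qweight N a b = 0")
    case True
    then have "a i = 0 \<and> b i = 0" if "i < N" for i using that by (auto simp: qweight_def)
    then have "a = zero" "b = zero"
      using that by (auto intro!: B_eqI simp: zero_eq)
    then show ?thesis
      unfolding detects_def by (intro exI[of _ 1]) (auto simp: code_def pauli_zero_zero)
  next
    case False
    with z[OF that(1,2) _ that(3)] show ?thesis
      unfolding detects_def by (intro exI[of _ 0]) auto
  qed
  then have "min_distance p N code d"
    unfolding min_distance_def error_set_def
    using d large not_detects[OF large(1,4,5,6,7)] by auto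
  ultimately show ?thesis
    using is_qcode_code[OF card] by (simp add: pure_qcode_def)
qed

end

section \<open>Stabilizer groups from generator matrices\<close>

text \<open>Integer rows are read modulo \<open>p\<close>. Orthogonality covers all pairs, also
  \<open>j = l\<close>, because it has to yield \<open>dot_G\<close>; independence makes the order
  of the group \<open>p ^ m\<close>.\<close>

locale stabilizer_matrix = qudits +
  fixes m :: nat and X Z :: "nat \<Rightarrow> nat \<Rightarrow> int"
  assumes orthogonal: "j < m \<Longrightarrow> l < m \<Longrightarrow> int p dvd (\<Sum>i<N. X j i * Z l i)"
    and independent: "(\<And>i. i < N \<Longrightarrow> int p dvd (\<Sum>j<m. c j * X j i)) \<Longrightarrow>
      (\<And>i. i < N \<Longrightarrow> int p dvd (\<Sum>j<m. c j * Z j i)) \<Longrightarrow> j < m \<Longrightarrow> int p dvd c j"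
begin

definition comb :: "(nat \<Rightarrow> nat \<Rightarrow> int) \<Rightarrow> (nat \<Rightarrow> int) \<Rightarrow> nat \<Rightarrow> int" where
  "comb Y c i = (\<Sum>j<m. c j * Y j i)"

definition element where "element c = (red (comb X c), red (comb Z c))"

definition G where "G = range element"

lemma element_diff: "element (\<lambda>j. c j - d j) = (sub (fst (element c)) (fst (element d)), sub (snd (element c)) (snd (element d)))"
  by (simp add: element_def sub_red_red comb_def[abs_def] left_diff_distrib sum_subtractf)

sublocale stabilizer_group p N G
proof
  show "G \<subseteq> B \<times> B" by (auto simp: G_def element_def)
  have "(zero, zero) = element (\<lambda>_. 0)" by (simp add: element_def comb_def[abs_def] zero_def)
  then show "(zero, zero) \<in> G" by (simp add: G_def)
next
  fix a b a' b' assume "(a, b) \<in> G" "(a', b') \<in> G"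
  then obtain c d where cd: "(a, b) = element c" "(a', b') = element d" by (auto simp: G_def)
  have "(sub a a', sub b b') = element (\<lambda>j. c j - d j)"
    unfolding element_diff by (simp flip: cd)
  then show "(sub a a', sub b b') \<in> G" by (simp add: G_def)
  have "(\<Sum>i<N. comb Z c i * comb X d i) = (\<Sum>i<N. \<Sum>j<m. \<Sum>l<m. c j * d l * (X l i * Z j i))"
    by (simp add: comb_def sum_product algebra_simps)
  also have "\<dots> = (\<Sum>j<m. \<Sum>i<N. \<Sum>l<m. c j * d l * (X l i * Z j i))"
    by (rule sum.swap)
  also have "\<dots> = (\<Sum>j<m. \<Sum>l<m. c j * d l * (\<Sum>i<N. X l i * Z j i))"
    unfolding sum_distrib_left by (intro sum.cong refl sum.swap)
  also have "int p dvd \<dots>" by (intro dvd_sum dvd_mult orthogonal) auto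
  finally show "int p dvd dot b a'"
    using cong_dvd_iff[OF dot_red_red[of "comb Z c" "comb X d"]] cd by (simp add: element_def)
qed

lemma card_G: "card G = p ^ m"
proof -
  \<comment> \<open>Coefficient vectors are treated as labels of \<open>m\<close> qudits, so that
    their reduction modulo \<open>p\<close> and their number are already known.\<close>
  interpret M: qudits p m by unfold_locales (rule prime)
  have inj: "inj_on (\<lambda>x. element (\<lambda>j. int (x j))) (basis_set p m)"
  proof (rule inj_onI)
    fix x y assume x: "x \<in> basis_set p m" and y: "y \<in> basis_set p m"
      and eq: "element (\<lambda>j. int (x j)) = element (\<lambda>j. int (y j))"
    have "element (\<lambda>j. int (x j) - int (y j)) = (zero, zero)"
      by (simp add: element_diff eq sub_self)
    then have "red (comb Y (\<lambda>j. int (x j) - int (y j))) = zero" if "Y = X \<or> Y = Z" for Y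
      using that by (auto simp: element_def)
    then have dvd: "int p dvd comb Y (\<lambda>j. int (x j) - int (y j)) i" if "Y = X \<or> Y = Z" "i < N" for Y i
      using cong_sym[OF cong_red[OF that(2), of "comb Y (\<lambda>j. int (x j) - int (y j))"]] that
      by (simp add: zero_eq cong_0_iff)
    have "int p dvd int (x j) - int (y j)" if "j < m" for j
      by (rule independent[of "\<lambda>j. int (x j) - int (y j)", OF dvd[of X, unfolded comb_def] dvd[of Z, unfolded comb_def] that])
        auto
    with x y show "x = y" by (intro M.B_eqI) (auto simp: cong_iff_dvd_diff)
  qed
  have "G = (\<lambda>x. element (\<lambda>j. int (x j))) ` basis_set p m"
  proof (intro equalityI subsetI)
    fix g assume "g \<in> G"
    then obtain c where g: "g = element c" by (auto simp: G_def)
    have "red (comb Y (\<lambda>j. int (M.red c j))) = red (comb Y c)" for Y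
      unfolding comb_def by (intro red_cong cong_sum cong_mult cong_refl M.cong_red) auto
    then have "g = element (\<lambda>j. int (M.red c j))" by (simp add: g element_def)
    then show "g \<in> (\<lambda>x. element (\<lambda>j. int (x j))) ` basis_set p m" by auto
  qed (auto simp: G_def)
  with inj show ?thesis by (simp add: card_image M.card_B)
qed

text \<open>The symplectic form is linear in the group element, so generators suffice; unit
  coefficient vectors give the converse.\<close>

lemma commutes_iff:
  "commutes a b \<longleftrightarrow> (\<forall>j<m. int p dvd (\<Sum>i<N. Z j i * int (a i) - int (b i) * X j i))"
proof -
  define s where "s j = (\<Sum>i<N. Z j i * int (a i) - int (b i) * X j i)" for j
  have 1: "(\<Sum>i<N. comb Z c i * int (a i) - int (b i) * comb X c i) = (\<Sum>j<m. c j * s j)" for c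
  proof -
    have "(\<Sum>i<N. comb Z c i * int (a i) - int (b i) * comb X c i)
        = (\<Sum>i<N. \<Sum>j<m. c j * (Z j i * int (a i) - int (b i) * X j i))"
      by (simp add: comb_def sum_distrib_left sum_distrib_right sum_subtractf[symmetric] algebra_simps)
    then show ?thesis unfolding s_def sum_distrib_left by (subst sum.swap) simp
  qed
  have 2: "[dot (red (comb Z c)) a - dot b (red (comb X c))
      = (\<Sum>i<N. comb Z c i * int (a i)) - (\<Sum>i<N. int (b i) * comb X c i)] (mod int p)" for c
    using dot_red[of a "comb Z c"] by (intro cong_diff dot_red) (simp add: dot_commute mult.commute)
  have "int p dvd dot (red (comb Z c)) a - dot b (red (comb X c)) \<longleftrightarrow> int p dvd (\<Sum>j<m. c j * s j)" for c
    unfolding 1[symmetric] sum_subtractf by (rule cong_dvd_iff[OF 2])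
  then have "commutes a b \<longleftrightarrow> (\<forall>c. int p dvd (\<Sum>j<m. c j * s j))"
    unfolding commutes_def by (simp add: G_def element_def)
  also have "\<dots> \<longleftrightarrow> (\<forall>j<m. int p dvd s j)"
  proof safe
    fix j assume all: "\<forall>c. int p dvd (\<Sum>j<m. c j * s j)" and "j < m"
    then have "(\<Sum>k<m. (if k = j then 1 else 0) * s k) = s j"
      by (simp add: if_distrib[of "\<lambda>x. x * _"] cong: if_cong)
    with all[rule_format, of "\<lambda>k. if k = j then 1 else 0"] show "int p dvd s j" by simp
  qed (auto intro!: dvd_sum)
  finally show ?thesis by (simp add: s_def)
qed

end

section \<open>Sums over base-\<open>p\<close> digits\<close>

text \<open>The higher digits are absorbed into the offset \<open>u\<close>. Keeping two digits serves \<open>p = 3\<close>, where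
  sums over a single digit do not annihilate quadratic polynomials.\<close>

definition digit_affine :: "nat \<Rightarrow> (nat \<Rightarrow> int) \<Rightarrow> bool" where
  "digit_affine p f \<longleftrightarrow> (\<exists>u v w. \<forall>i. f i =
     u (i div p\<^sup>2) + v * int (i mod p) + w * int (i div p mod p))"

definition digit :: "nat \<Rightarrow> nat \<Rightarrow> nat \<Rightarrow> int" where
  "digit p l i = int (i div p ^ l mod p)"

lemma digit_affine_const: "digit_affine p (\<lambda>_. c)"
  unfolding digit_affine_def by (intro exI[of _ "\<lambda>_. c"] exI[of _ 0]) simp

lemma digit_affine_add:
  assumes "digit_affine p f" "digit_affine p h"
  shows "digit_affine p (\<lambda>i. f i + h i)"
proof -
  from assms obtain u v w u' v' w' where
    "\<And>i. f i = u (i div p\<^sup>2) + v * int (i mod p) + w * int (i div p mod p)"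
    "\<And>i. h i = u' (i div p\<^sup>2) + v' * int (i mod p) + w' * int (i div p mod p)"
    unfolding digit_affine_def by metis
  then show ?thesis unfolding digit_affine_def
    by (intro exI[of _ "\<lambda>k. u k + u' k"] exI[of _ "v + v'"] exI[of _ "w + w'"])
      (simp add: algebra_simps)
qed

lemma digit_affine_cmult:
  assumes "digit_affine p f" shows "digit_affine p (\<lambda>i. c * f i)"
proof -
  from assms obtain u v w where
    "\<And>i. f i = u (i div p\<^sup>2) + v * int (i mod p) + w * int (i div p mod p)"
    unfolding digit_affine_def by metis
  then show ?thesis unfolding digit_affine_def
    by (intro exI[of _ "\<lambda>k. c * u k"] exI[of _ "c * v"] exI[of _ "c * w"])
      (simp add: algebra_simps)
qed

lemma digit_affine_digit: "digit_affine p (digit p l)"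
proof -
  consider "l = 0" | "l = 1" | k where "l = 2 + k"
    by (metis One_nat_def Suc_1 add_2_eq_Suc le_Suc_ex less_2_cases not_less)
  then show ?thesis
  proof cases
    case 1
    then show ?thesis unfolding digit_affine_def digit_def
      by (intro exI[of _ "\<lambda>_. 0"] exI[of _ 1] exI[of _ 0]) simp
  next
    case 2
    then show ?thesis unfolding digit_affine_def digit_def
      by (intro exI[of _ "\<lambda>_. 0"] exI[of _ 1] exI[of _ 0]) simp
  next
    \<comment> \<open>Digits from place 2 on are functions of \<open>i div p\<^sup>2\<close>
      alone.\<close>
    case (3 k)
    then show ?thesis unfolding digit_affine_def digit_def
      by (intro exI[of _ "\<lambda>q. int (q div p ^ k mod p)"] exI[of _ 0])
        (simp add: power_add div_mult2_eq power2_eq_square)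
  qed
qed

lemma sum_blocks:
  fixes f :: "nat \<Rightarrow> int"
  shows "(\<Sum>i<t * q. f i) = (\<Sum>k<t. \<Sum>r<q. f (k * q + r))"
proof -
  have "(\<Sum>i<t * q. f i) = (\<Sum>k<t. sum f {k * q..<k * q + q})"
    by (rule sum.nat_group[symmetric])
  also have "\<dots> = (\<Sum>k<t. \<Sum>r<q. f (k * q + r))"
  proof (rule sum.cong[OF refl])
    fix k
    show "sum f {k * q..<k * q + q} = (\<Sum>r<q. f (k * q + r))"
      using sum.shift_bounds_nat_ivl[of f 0 "k * q" q] by (simp add: add.commute atLeast0LessThan)
  qed
  finally show ?thesis .
qed

text \<open>The closed forms of the power sums have a factor \<open>p\<close> and denominators 2, 6
  and 4, which are invertible modulo a prime \<open>p \<ge> 5\<close>.\<close>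

lemma dvd_sum_powers:
  assumes "prime p" "p \<ge> 5" "e \<le> 3"
  shows "int p dvd (\<Sum>r<p. int r ^ e)"
proof -
  have 1: "2 * (\<Sum>r<q. int r) = int q * (int q - 1)" for q
    by (induction q) (simp_all add: algebra_simps)
  have 2: "6 * (\<Sum>r<q. (int r)\<^sup>2) = int q * ((int q - 1) * (2 * int q - 1))" for q
    by (induction q) (simp_all add: algebra_simps power2_eq_square)
  have 3: "4 * (\<Sum>r<q. int r ^ 3) = int q * (int q * (int q - 1)\<^sup>2)" for q
    by (induction q) (simp_all add: algebra_simps power2_eq_square power3_eq_cube)
  have p: "prime (int p)" using assms by simp
  have n: "\<not> int p dvd 2" "\<not> int p dvd 3"
    using assms(2) zdvd_imp_le[of "int p" 2] zdvd_imp_le[of "int p" 3] by auto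
  then have "\<not> int p dvd 2 * 3" "\<not> int p dvd 2 * 2"
    using prime_dvd_mult_iff[OF p] by blast+
  then have n': "\<not> int p dvd 6" "\<not> int p dvd 4" by simp_all
  consider "e = 0" | "e = 1" | "e = 2" | "e = 3" using assms by linarith
  then show ?thesis
  proof cases
    case 2
    have "int p dvd 2 * (\<Sum>r<p. int r)" unfolding 1 by simp
    with n p 2 show ?thesis by (simp add: prime_dvd_mult_iff)
  next
    case 3
    have "int p dvd 6 * (\<Sum>r<p. (int r)\<^sup>2)" unfolding 2 by simp
    with n' p 3 show ?thesis by (simp add: prime_dvd_mult_iff)
  next
    case 4
    have "int p dvd 4 * (\<Sum>r<p. int r ^ 3)" unfolding 3 by simp
    with n' p 4 show ?thesis by (simp add: prime_dvd_mult_iff)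
  qed simp
qed

text \<open>\<open>?P\<close> serves the orthogonality of the rows, \<open>?Q\<close> the error
  \<open>X((i mod p)\<^sup>2)\<close> that witnesses the exact distance.\<close>

lemma dvd_sum_digit_affine:
  assumes p: "prime p" "odd p" "p dvd N" "p = 3 \<longrightarrow> 9 dvd N"
    and "digit_affine p f" "digit_affine p h"
  shows "int p dvd (\<Sum>i<N. f i * h i)" (is ?P)
    and "int p dvd (\<Sum>i<N. f i * (int (i mod p))\<^sup>2)" (is ?Q)
proof -
  obtain u v w u' v' w' where
    f: "\<And>i. f i = u (i div p\<^sup>2) + v * int (i mod p) + w * int (i div p mod p)" and
    h: "\<And>i. h i = u' (i div p\<^sup>2) + v' * int (i mod p) + w' * int (i div p mod p)"
    using assms(5,6) unfolding digit_affine_def by metis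
  have "?P \<and> ?Q"
  proof (cases "p = 3")
    case True
    then obtain t where N: "N = t * 9" using p by (auto elim: dvdE)
    have *: "(k * 9 + r) div 9 = k" "(k * 9 + r) mod 3 = r mod 3" "(k * 9 + r) div 3 mod 3 = r div 3"
      if "r < 9" for k r :: nat
    proof -
      have "k * 9 + r = r + (3 * k) * 3" by simp
      moreover have "(r div 3 + 3 * k) mod 3 = r div 3" using that by simp
      ultimately show "(k * 9 + r) mod 3 = r mod 3" "(k * 9 + r) div 3 mod 3 = r div 3"
        by (simp_all only: mod_mult_self1 div_mult_self1 zero_neq_numeral not_False_eq_True)
          (simp_all add: add.commute)
    qed (use that in simp)
    have F: "f (k * 9 + r) = u k + v * int (r mod 3) + w * int (r div 3)"
      and H: "h (k * 9 + r) = u' k + v' * int (r mod 3) + w' * int (r div 3)" if "r < 9" for k r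
      using *[OF that] by (simp_all add: f h True)
    have nine: "{..<9} = {0, 1, 2, 3, 4, 5, 6, 7, 8::nat}" by auto
    have "(\<Sum>r<9. f (k * 9 + r) * h (k * 9 + r)) =
        (\<Sum>r<9. (u k + v * int (r mod 3) + w * int (r div 3)) * (u' k + v' * int (r mod 3) + w' * int (r div 3)))" for k
      by (intro sum.cong refl) (simp add: F H)
    \<comment> \<open>With digits x (lowest) and y, the sums over the nine pairs are 9 for 1, x, y
      and xy, and 15 for each square.\<close>
    also have "\<dots> k = 3 * (3 * u k * u' k + 3 * (u k * v' + v * u' k) + 3 * (u k * w' + w * u' k)
          + 5 * v * v' + 5 * w * w' + 3 * (v * w' + w * v'))" for k
      by (simp add: nine) (simp add: algebra_simps)
    finally have 1: "int 3 dvd (\<Sum>r<9. f (k * 9 + r) * h (k * 9 + r))" for k by simp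
    have "(\<Sum>r<9. f (k * 9 + r) * (int ((k * 9 + r) mod 3))\<^sup>2) =
        (\<Sum>r<9. (u k + v * int (r mod 3) + w * int (r div 3)) * (int (r mod 3))\<^sup>2)" for k
      by (intro sum.cong refl) (simp add: F *)
    \<comment> \<open>Here the sums are 15 for the square of x, 27 for its cube, and 15 for the
      square times y.\<close>
    also have "\<dots> k = 3 * (5 * u k + 9 * v + 5 * w)" for k
      by (simp add: nine)
    finally have 2: "int 3 dvd (\<Sum>r<9. f (k * 9 + r) * (int ((k * 9 + r) mod 3))\<^sup>2)" for k by simp
    show ?thesis
      unfolding N sum_blocks True by (intro conjI; rule dvd_sum; (rule 1 | rule 2))
  next
    case False
    have "p > 2" using p prime_gt_1_nat[of p] by (cases "p = 2") auto
    moreover have "p \<noteq> 4" using p by auto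
    ultimately have p5: "p \<ge> 5" using False by linarith
    obtain t where N: "N = t * p" using p by (auto elim: dvdE)
    \<comment> \<open>One digit suffices for \<open>p \<ge> 5\<close>, so the next digit joins the
      offset.\<close>
    define U where "U k = u (k div p) + w * int (k mod p)" for k
    define U' where "U' k = u' (k div p) + w' * int (k mod p)" for k
    have F: "f (k * p + r) = U k + v * int r" and H: "h (k * p + r) = U' k + v' * int r"
      if "r < p" for k r
      using that by (simp_all add: f h U_def U'_def power2_eq_square div_mult2_eq)
    note powers = dvd_sum_powers[OF p(1) p5]
    have 1: "int p dvd (\<Sum>r<p. f (k * p + r) * h (k * p + r))" for k
    proof -
      have "(\<Sum>r<p. f (k * p + r) * h (k * p + r)) =
          (\<Sum>r<p. U k * U' k * int r ^ 0 + (U k * v' + v * U' k) * int r ^ 1 + v * v' * int r ^ 2)"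
        by (intro sum.cong refl) (simp add: F H, simp add: algebra_simps power2_eq_square)
      also have "\<dots> = U k * U' k * (\<Sum>r<p. int r ^ 0)
          + (U k * v' + v * U' k) * (\<Sum>r<p. int r ^ 1) + v * v' * (\<Sum>r<p. int r ^ 2)"
        by (simp only: sum.distrib sum_distrib_left)
      also have "int p dvd \<dots>" by (rule dvd_add[OF dvd_add]; rule dvd_mult; rule powers; simp)
      finally show ?thesis .
    qed
    have 2: "int p dvd (\<Sum>r<p. f (k * p + r) * (int ((k * p + r) mod p))\<^sup>2)" for k
    proof -
      have "(\<Sum>r<p. f (k * p + r) * (int ((k * p + r) mod p))\<^sup>2) =
          (\<Sum>r<p. U k * int r ^ 2 + v * int r ^ 3)"
        by (intro sum.cong refl) (simp add: F, simp add: algebra_simps power2_eq_square power3_eq_cube)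
      also have "\<dots> = U k * (\<Sum>r<p. int r ^ 2) + v * (\<Sum>r<p. int r ^ 3)"
        by (simp only: sum.distrib sum_distrib_left)
      also have "int p dvd \<dots>" by (rule dvd_add; rule dvd_mult; rule powers; simp)
      finally show ?thesis .
    qed
    show ?thesis
      unfolding N sum_blocks by (intro conjI; rule dvd_sum; (rule 1 | rule 2))
  qed
  then show ?P ?Q by auto
qed

lemma nat_eq_if_digits_eq:
  assumes "p > 0" "i < p ^ n" "i' < p ^ n" "\<And>l. l < n \<Longrightarrow> digit p l i = digit p l i'"
  shows "i = i'"
  using assms
proof (induction n arbitrary: i i')
  case (Suc n)
  have "digit p l (i div p) = digit p l (i' div p)" if "l < n" for l
    using Suc.prems(4)[of "Suc l"] that by (simp add: digit_def div_mult2_eq)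
  moreover have "i div p < p ^ n" "i' div p < p ^ n"
    using Suc.prems by (auto simp: less_mult_imp_div_less mult.commute)
  ultimately have "i div p = i' div p" using Suc by blast
  moreover have "i mod p = i' mod p" using Suc.prems(4)[of 0] by (simp add: digit_def)
  ultimately show ?case by (metis div_mult_mod_eq)
qed simp

lemma digit_power: "p > 1 \<Longrightarrow> digit p l (p ^ q) = (if l = q then 1 else 0)"
proof -
  assume p: "p > 1"
  consider "l = q" | k where "q = l + Suc k" | "q < l"
    by (metis add_Suc_right less_imp_Suc_add linorder_neqE_nat)
  then show ?thesis
    using p by cases (auto simp: digit_def power_add power_strict_increasing)
qed

text \<open>\<open>x \<mapsto> x ^ n - x\<close> takes the value 0 at both 0 and 1, so it misses some value modulo \<open>p\<close>.\<close>

lemma ex_rootless_trinomial: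
  assumes "p > 1" "n \<ge> 1"
  obtains g :: int where "\<And>c. \<not> int p dvd c ^ n - c - g"
proof -
  define F where "F c = (c ^ n - c) mod int p" for c :: int
  have "F ` {0..<int p} \<noteq> {0..<int p}"
  proof
    assume "F ` {0..<int p} = {0..<int p}"
    then have "inj_on F {0..<int p}" by (intro eq_card_imp_inj_on) auto
    moreover have "F 0 = F 1" using assms by (simp add: F_def power_0_left)
    ultimately show False using assms by (auto dest: inj_onD[of F _ 0 1])
  qed
  moreover have "F ` {0..<int p} \<subseteq> {0..<int p}" using assms by (auto simp: F_def)
  ultimately obtain g where g: "g \<in> {0..<int p}" "g \<notin> F ` {0..<int p}" by blast
  have "\<not> int p dvd c ^ n - c - g" for c
  proof
    assume "int p dvd c ^ n - c - g"
    then have "(c ^ n - c) mod int p = g mod int p" by (simp only: mod_eq_dvd_iff)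
    also have "\<dots> = g" using g(1) by simp
    finally have "F (c mod int p) = g"
      unfolding F_def by (metis mod_diff_eq mod_mod_trivial power_mod)
    moreover have "c mod int p \<in> {0..<int p}" using assms by simp
    ultimately show False using g(2) by blast
  qed
  then show thesis by (rule that)
qed

section \<open>The code built from digit vectors\<close>

text \<open>\<open>N_upper\<close> gives distinct positions distinct digit vectors. For
  independence, \<open>N_lower\<close> makes \<open>p ^ q\<close> a position for
  \<open>q \<le> n - 3\<close>, and \<open>N_3\<close> adds \<open>p\<close> if
  \<open>n = 3\<close>. Divisibility serves orthogonality; \<open>rootless\<close> excludes
  eigenvalues.\<close>

locale digit_code = qudits +
  fixes n :: nat and g :: int
  assumes odd_p: "odd p" and n: "n \<ge> 3"
    and N_lower: "p ^ (n - 2) \<le> N" and N_upper: "N \<le> p ^ n" and N_3: "n = 3 \<Longrightarrow> p < N"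
    and p_dvd: "p dvd N" and nine_dvd: "p = 3 \<Longrightarrow> 9 dvd N"
    and rootless: "\<not> int p dvd c ^ n - c - g"
begin

text \<open>The order of the digits is chosen such that \<open>v\<close> and \<open>Mv\<close> together span the whole space
  even if \<open>i\<close> only ranges over \<open>i < p ^ (n - 2)\<close>, where the two highest digits vanish.\<close>

definition order :: "nat \<Rightarrow> nat" where
  "order j = (if j = 0 then n - 1 else if j = 1 then 0 else if j = 2 then n - 2 else j - 2)"

definition v :: "nat \<Rightarrow> nat \<Rightarrow> int" where
  "v j = digit p (order j)"

text \<open>The companion matrix of \<open>x ^ n - x - g\<close>, which has no eigenvalue modulo \<open>p\<close>, applied to \<open>v\<close>.\<close>

definition Mv :: "nat \<Rightarrow> nat \<Rightarrow> int" where
  "Mv j i = (if Suc j < n then v (Suc j) i else v 1 i + g * v 0 i)"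

definition rowX :: "nat \<Rightarrow> nat \<Rightarrow> int" where
  "rowX j i = (if j = 0 then 1 else if j = 1 then 0 else v (j - 2) i)"

definition rowZ :: "nat \<Rightarrow> nat \<Rightarrow> int" where
  "rowZ j i = (if j = 0 then 0 else if j = 1 then 1 else Mv (j - 2) i)"

lemma digit_affine_v: "digit_affine p (v j)"
  by (simp add: v_def[abs_def] digit_affine_digit)

lemma digit_affine_Mv: "digit_affine p (Mv j)"
  using digit_affine_add[OF digit_affine_v digit_affine_cmult[OF digit_affine_v], of 1 g 0]
    digit_affine_v[of "Suc j"]
  by (cases "Suc j < n") (simp_all add: Mv_def[abs_def])

lemma digit_affine_rowX: "digit_affine p (rowX j)"
  using digit_affine_const[of p 0] digit_affine_const[of p 1] digit_affine_v[of "j - 2"]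
  by (cases "j = 0"; cases "j = 1") (simp_all add: rowX_def[abs_def])

lemma digit_affine_rowZ: "digit_affine p (rowZ j)"
  using digit_affine_const[of p 0] digit_affine_const[of p 1] digit_affine_Mv[of "j - 2"]
  by (cases "j = 0"; cases "j = 1") (simp_all add: rowZ_def[abs_def])

lemma sum_rows:
  "(\<Sum>j<n + 2. c j * rowX j i) = c 0 + (\<Sum>j<n. c (j + 2) * v j i)"
  "(\<Sum>j<n + 2. c j * rowZ j i) = c 1 + (\<Sum>j<n. c (j + 2) * Mv j i)"
  by (simp_all add: rowX_def rowZ_def sum.lessThan_Suc_shift del: sum.lessThan_Suc)

lemma digit_0: "digit p l 0 = 0"
  by (simp add: digit_def)

lemma v_0: "v j 0 = 0" and Mv_0: "Mv j 0 = 0"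
  by (simp_all add: v_def Mv_def digit_0)

lemma v_power: "v j (p ^ q) = (if order j = q then 1 else 0)"
  using digit_power[OF p_gt_1] by (simp add: v_def)

lemma order_inj: "j < n \<Longrightarrow> l < n \<Longrightarrow> order j = order l \<Longrightarrow> j = l"
  using n by (auto simp: order_def split: if_splits)

lemma power_less_N: "q \<le> n - 3 \<Longrightarrow> p ^ q < N"
proof -
  assume "q \<le> n - 3"
  then have "p ^ q < p ^ (n - 2)" using p_gt_1 n by (intro power_strict_increasing) auto
  with N_lower show ?thesis by simp
qed

sublocale stabilizer_matrix p N "n + 2" rowX rowZ
proof
  fix j l
  show "int p dvd (\<Sum>i<N. rowX j i * rowZ l i)"
    by (rule dvd_sum_digit_affine[OF prime odd_p p_dvd _ digit_affine_rowX digit_affine_rowZ])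
      (simp add: nine_dvd)
next
  fix c :: "nat \<Rightarrow> int" and j
  assume X: "\<And>i. i < N \<Longrightarrow> int p dvd (\<Sum>j<n + 2. c j * rowX j i)"
    and Z: "\<And>i. i < N \<Longrightarrow> int p dvd (\<Sum>j<n + 2. c j * rowZ j i)"
    and j: "j < n + 2"
  define w where "w j = c (j + 2)" for j
  have N: "0 < N" "1 < N" using power_less_N[of 0] by auto
  \<comment> \<open>At position 0 both \<open>v\<close> and \<open>Mv\<close> vanish, which isolates
    the first two coefficients.\<close>
  have c: "int p dvd c 0" "int p dvd c 1"
    using X[OF N(1)] Z[OF N(1)] unfolding sum_rows by (simp_all add: v_0 Mv_0)
  have vw: "int p dvd (\<Sum>j<n. w j * v j i)" "int p dvd (\<Sum>j<n. w j * Mv j i)" if "i < N" for i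
    using X[OF that] Z[OF that] c unfolding sum_rows w_def by (simp_all add: dvd_add_right_iff)
  \<comment> \<open>At position \<open>p ^ order j\<close> the vector \<open>v\<close> is the unit
    vector of index \<open>j\<close>.\<close>
  have v_small: "int p dvd w j" if "j < n" "p ^ order j < N" for j
  proof -
    have "(\<Sum>l<n. w l * v l (p ^ order j)) = (\<Sum>l<n. if l = j then w l else 0)"
      using that(1) by (intro sum.cong) (auto simp: v_power dest: order_inj)
    with vw(1)[OF that(2)] that(1) show ?thesis by simp
  qed
  have Mv: "(\<Sum>l<n. w l * Mv l i) = (\<Sum>l<n - 1. w l * v (Suc l) i) + w (n - 1) * (v 1 i + g * v 0 i)" for i
  proof -
    have "(\<Sum>l<n. w l * Mv l i) = (\<Sum>l<n - 1. w l * Mv l i) + w (n - 1) * Mv (n - 1) i"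
      using sum.lessThan_Suc[of "\<lambda>l. w l * Mv l i" "n - 1"] n by simp
    moreover have "(\<Sum>l<n - 1. w l * Mv l i) = (\<Sum>l<n - 1. w l * v (Suc l) i)"
      by (intro sum.cong) (auto simp: Mv_def)
    ultimately show ?thesis using n by (simp add: Mv_def)
  qed
  \<comment> \<open>Coordinate 2 carries digit \<open>n - 2\<close>, whose power of \<open>p\<close>
    need not be a position if \<open>n > 3\<close>. In that case position \<open>p\<close> is used
    with the \<open>Z\<close> rows: its unit vector of index 3 is sent to that of index 2.\<close>
  have 2: "int p dvd w 2"
  proof (cases "n = 3")
    case True
    then have "order 2 = 1" unfolding order_def by simp
    then show ?thesis using v_small[of 2] n N_3[OF True] by simp
  next
    case False
    have "p ^ 1 < N" using power_less_N[of 1] n False by simp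
    from vw(2)[OF this] have "int p dvd (\<Sum>l<n - 1. w l * v (Suc l) (p ^ 1)) + w (n - 1) * (v 1 (p ^ 1) + g * v 0 (p ^ 1))"
      unfolding Mv .
    moreover have "(\<Sum>l<n - 1. w l * v (Suc l) (p ^ 1)) = (\<Sum>l<n - 1. if l = 2 then w l else 0)"
      unfolding v_power using n False by (intro sum.cong) (auto simp: order_def)
    moreover have "v 1 (p ^ 1) + g * v 0 (p ^ 1) = 0"
      unfolding v_power using n False by (auto simp: order_def)
    moreover have "2 < n - 1" using n False by simp
    ultimately show ?thesis by simp
  qed
  have pos: "int p dvd w l" if "l < n" "l \<noteq> 0" for l
  proof (cases "l = 2")
    case False
    then have "order l \<le> n - 3" using that n by (auto simp: order_def)
    with power_less_N v_small that show ?thesis by blast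
  qed (use 2 in simp)
  \<comment> \<open>At position 1 the matrix sends unit vector 1 to the sum of unit vectors 0 and
    \<open>n - 1\<close>, and the coefficient \<open>w (n - 1)\<close> is already known to vanish
    modulo \<open>p\<close>.\<close>
  have "p ^ 0 < N" using N by simp
  from vw(2)[OF this] have "int p dvd (\<Sum>l<n - 1. w l * v (Suc l) (p ^ 0)) + w (n - 1) * (v 1 (p ^ 0) + g * v 0 (p ^ 0))"
    unfolding Mv .
  moreover have "(\<Sum>l<n - 1. w l * v (Suc l) (p ^ 0)) = (\<Sum>l<n - 1. if l = 0 then w l else 0)"
    unfolding v_power using n by (intro sum.cong) (auto simp: order_def)
  moreover have "int p dvd w (n - 1)" using pos[of "n - 1"] n by simp
  ultimately have 0: "int p dvd w 0" using n by (simp add: dvd_add_left_iff)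
  consider "j = 0" | "j = 1" | l where "j = l + 2" "l < n"
    using j by (metis add.commute add_2_eq_Suc le_add_diff_inverse2 less_2_cases nat_add_left_cancel_less not_less One_nat_def)
  then show "int p dvd c j"
  proof cases
    case 3
    with pos 0 show ?thesis unfolding w_def by (cases "l = 0") auto
  qed (use c in auto)
qed

section \<open>Purity and exact distance of the digit code\<close>

text \<open>Rows 0 and 1 make the entries at \<open>i'\<close> the negatives of those at
  \<open>i\<close>. The other rows then read \<open>a i * Md = b i * d\<close> modulo
  \<open>p\<close> for the difference \<open>d\<close> of the digit vectors. As \<open>d\<close> is
  nonzero and no eigenvector, \<open>a i\<close> vanishes, and then so does
  \<open>b i\<close>.\<close>

lemma commutes_weight_2:
  assumes a: "a \<in> B" and b: "b \<in> B" and comm: "commutes a b"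
    and i: "i < N" "i' < N" "i \<noteq> i'"
    and supp: "\<And>k. k < N \<Longrightarrow> k \<noteq> i \<Longrightarrow> k \<noteq> i' \<Longrightarrow> a k = 0 \<and> b k = 0"
  shows "qweight N a b = 0"
proof -
  have two: "(\<Sum>k<N. f k) = f i + f i'" if "\<And>k. k < N \<Longrightarrow> k \<noteq> i \<Longrightarrow> k \<noteq> i' \<Longrightarrow> f k = 0" for f :: "nat \<Rightarrow> int"
  proof -
    have "(\<Sum>k<N. f k) = sum f {i, i'}"
      by (rule sum.mono_neutral_right) (use i that in auto)
    with i show ?thesis by simp
  qed
  have row: "int p dvd (rowZ j i * int (a i) - int (b i) * rowX j i) + (rowZ j i' * int (a i') - int (b i') * rowX j i')"
    if "j < n + 2" for j
    using comm[unfolded commutes_iff] that supp by (subst two[symmetric]) auto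
  have b0: "int p dvd int (b i) + int (b i')"
    using row[of 0] dvd_minus_iff[of "int p" "int (b i) + int (b i')"] by (simp add: rowX_def rowZ_def)
  have a0: "int p dvd int (a i) + int (a i')"
    using row[of 1] by (simp add: rowX_def rowZ_def)
  define d where "d j = v j i - v j i'" for j
  define Md where "Md j = Mv j i - Mv j i'" for j
  have eigen: "int p dvd int (a i) * Md j - int (b i) * d j" if "j < n" for j
  proof -
    have r: "int p dvd (Mv j i * int (a i) - int (b i) * v j i) + (Mv j i' * int (a i') - int (b i') * v j i')"
      using row[of "j + 2"] that by (simp add: rowX_def rowZ_def)
    have "int p dvd (Mv j i * int (a i) - int (b i) * v j i) + (Mv j i' * int (a i') - int (b i') * v j i')
        - Mv j i' * (int (a i) + int (a i')) + v j i' * (int (b i) + int (b i'))"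
      by (rule dvd_add[OF dvd_diff[OF r dvd_mult[OF a0]] dvd_mult[OF b0]])
    then show ?thesis by (simp add: d_def Md_def algebra_simps)
  qed
  have pp: "prime (int p)" using prime by simp
  \<comment> \<open>Distinct positions differ in some digit, and \<open>order\<close> permutes the
    digit places, so some \<open>d j0\<close> is nonzero modulo \<open>p\<close>.\<close>
  have "\<exists>l<n. digit p l i \<noteq> digit p l i'"
    using nat_eq_if_digits_eq[OF p_pos, of i n i'] i N_upper by force
  then obtain l where l: "l < n" "digit p l i \<noteq> digit p l i'" by blast
  have "\<exists>j<n. order j = l"
  proof -
    have "order ` {..<n} = {..<n}"
    proof (rule endo_inj_surj)
      show "order ` {..<n} \<subseteq> {..<n}" using n by (auto simp: order_def)
      show "inj_on order {..<n}" by (rule inj_onI) (rule order_inj, simp_all)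
    qed simp
    then have "l \<in> order ` {..<n}" using l by simp
    then show ?thesis by auto
  qed
  then obtain j0 where j0: "j0 < n" "order j0 = l" by blast
  have d_nz: "\<not> int p dvd d j0"
  proof
    assume "int p dvd d j0"
    then have "int (i div p ^ l mod p) mod int p = int (i' div p ^ l mod p) mod int p"
      by (simp add: d_def v_def digit_def j0 mod_eq_dvd_iff del: of_nat_mod)
    then show False using l by (simp add: digit_def flip: of_nat_mod)
  qed
  have ai: "int p dvd int (a i)"
  proof (rule ccontr)
    assume na: "\<not> int p dvd int (a i)"
    then have "coprime (int (a i)) (int p)"
      using prime_imp_coprime[OF pp] coprime_commute by blast
    then obtain e where e: "[int (a i) * e = 1] (mod int p)" using cong_solve_coprime_int by blast
    define c where "c = int (b i) * e"
    have Mdc: "int p dvd Md j - c * d j" if "j < n" for j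
    proof -
      have "int p dvd e * (int (a i) * Md j - int (b i) * d j) - (int (a i) * e - 1) * Md j"
        using e by (intro dvd_diff[OF dvd_mult[OF eigen[OF that]] dvd_mult2]) (simp add: cong_iff_dvd_diff)
      then show ?thesis by (simp add: c_def algebra_simps)
    qed
    \<comment> \<open>In companion form an eigenvector satisfies \<open>d (j + 1) = c * d j\<close>.
      The last row closes the recursion to \<open>(c ^ n - c - g) * d 0 = 0\<close>, so
      \<open>d 0\<close> and with it all of \<open>d\<close> vanish modulo \<open>p\<close>.\<close>
    have pow: "int p dvd d j - c ^ j * d 0" if "j < n" for j
      using that
    proof (induction j)
      case (Suc j)
      have "Md j = d (Suc j)" using Suc.prems by (simp add: Md_def d_def Mv_def)
      then have "int p dvd (d (Suc j) - c * d j) + c * (d j - c ^ j * d 0)"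
        using Mdc[of j] Suc by (intro dvd_add[OF _ dvd_mult]) simp_all
      then show ?case by (simp add: algebra_simps)
    qed simp
    define k where "k = n - 1"
    have k: "\<not> Suc k < n" "k < n" "1 < n" using n by (auto simp: k_def)
    have "Suc k = n" using n by (simp add: k_def)
    then have cn: "c ^ n = c * c ^ k" by (metis power_Suc)
    have "Md k = d 1 + g * d 0" using k(1) by (simp add: Md_def d_def Mv_def algebra_simps)
    then have "int p dvd (d 1 + g * d 0 - c * d k) - (d 1 - c ^ 1 * d 0) + c * (d k - c ^ k * d 0)"
      using Mdc[of k] pow[of k] k
      by (intro dvd_add[OF dvd_diff[OF _ pow[of 1]] dvd_mult]) simp_all
    also have "\<dots> = - ((c ^ n - c - g) * d 0)" by (simp add: cn algebra_simps)
    finally have "int p dvd (c ^ n - c - g) * d 0" by (simp only: dvd_minus_iff)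
    then have "int p dvd d 0" using rootless prime_dvd_mult_iff[OF pp] by blast
    then have "int p dvd (d j0 - c ^ j0 * d 0) + c ^ j0 * d 0"
      by (rule dvd_add[OF pow[OF j0(1)] dvd_mult])
    with d_nz show False by simp
  qed
  have "int p dvd Md j0 * int (a i) - (int (a i) * Md j0 - int (b i) * d j0)"
    by (rule dvd_diff[OF dvd_mult[OF ai] eigen[OF j0(1)]])
  then have "int p dvd int (b i) * d j0" by (simp add: mult.commute)
  then have bi: "int p dvd int (b i)" using d_nz prime_dvd_mult_iff[OF pp] by blast
  have B_dvd: "x k = 0" if "x \<in> B" "k < N" "int p dvd int (x k)" for x k
  proof -
    have "x k < p" using that by (auto simp: basis_set_def PiE_iff)
    with that(3) show ?thesis by (auto dest: nat_dvd_not_less)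
  qed
  have "int p dvd int (a i')" "int p dvd int (b i')"
    using a0 b0 dvd_add_right_iff[OF ai] dvd_add_right_iff[OF bi] by blast+
  then have "a i = 0" "b i = 0" "a i' = 0" "b i' = 0"
    using B_dvd a b i ai bi by blast+
  then have "a k = 0 \<and> b k = 0" if "k < N" for k
    using supp[OF that] by (cases "k = i"; cases "k = i'") auto
  then show ?thesis by (simp add: qweight_def)
qed

lemma commutes_small_weight:
  assumes "a \<in> B" "b \<in> B" "1 \<le> qweight N a b" "qweight N a b < 3"
  shows "\<not> commutes a b"
proof
  assume comm: "commutes a b"
  define S where "S = {i\<in>{0..<N}. a i \<noteq> 0 \<or> b i \<noteq> 0}"
  have S: "card S = 1 \<or> card S = 2" "S \<subseteq> {0..<N}" using assms by (auto simp: qweight_def S_def)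
  have "1 < N" using power_less_N[of 0] by simp
  \<comment> \<open>A support of size 1 is padded by an arbitrary second position.\<close>
  obtain i i' where "i < N" "i' < N" "i \<noteq> i'" "S \<subseteq> {i, i'}"
  proof (cases "card S = 1")
    case True
    then obtain i where i: "S = {i}" by (auto simp: card_1_singleton_iff)
    with S have "i < N" by auto
    moreover obtain i' where "i' < N" "i' \<noteq> i"
      using \<open>1 < N\<close> by (metis less_trans zero_less_one zero_neq_one)
    ultimately show ?thesis using that i by blast
  next
    case False
    with S(1) obtain i i' where "S = {i, i'}" "i \<noteq> i'" by (auto simp: card_2_iff)
    with S(2) that show ?thesis by auto
  qed
  with commutes_weight_2[OF assms(1,2) comm, of i i'] have "qweight N a b = 0"
    by (force simp: S_def)
  with assms show False by simp
qed

text \<open>The undetected error \<open>Z(1, -2, 1)\<close> at the first three positions, where all rows are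
  affine in \<open>i\<close>, does not commute with \<open>X((i mod p)\<^sup>2)\<close>.\<close>

lemma pure_qcode: "\<exists>Q. pure_qcode p N (N - n - 2) 3 Q" and length_ge: "n + 2 \<le> N"
proof -
  have p3: "p \<ge> 3" using odd_p p_gt_1 by (cases "p = 2") auto
  have "p \<le> N" using p_dvd power_less_N[of 0] by (intro dvd_imp_le) auto
  then have N3: "3 \<le> N" using p3 by simp
  define f :: "nat \<Rightarrow> int" where "f i = (if i = 0 then 1 else if i = 1 then - 2 else if i = 2 then 1 else 0)" for i
  define h :: "nat \<Rightarrow> int" where "h i = (int (i mod p))\<^sup>2" for i
  have f: "(\<Sum>i<N. f i * y i) = y 0 - 2 * y 1 + y 2" for y :: "nat \<Rightarrow> int"
  proof -
    have "(\<Sum>i<N. f i * y i) = (\<Sum>i\<in>{0, 1, 2}. f i * y i)"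
      by (rule sum.mono_neutral_right) (use N3 in \<open>auto simp: f_def\<close>)
    then show ?thesis by (simp add: f_def)
  qed
  have np: "\<not> int p dvd 1" "\<not> int p dvd 2"
    using p3 zdvd_imp_le[of "int p" 1] zdvd_imp_le[of "int p" 2] by auto
  have red_f: "red f i \<noteq> 0 \<longleftrightarrow> i < 3" if "i < N" for i
  proof -
    have "red f i = 0 \<longleftrightarrow> int p dvd f i"
      using that p_pos by (auto simp: red_def dvd_eq_mod_eq_0 intro: antisym)
    with np show ?thesis by (auto simp: f_def dvd_minus_iff[of _ 2])
  qed
  have supp: "i < N \<and> (zero i \<noteq> 0 \<or> red f i \<noteq> 0) \<longleftrightarrow> i < 3" for i
    using red_f[of i] N3 by (cases "i < N") (auto simp: zero_eq)
  have "{i \<in> {0..<N}. zero i \<noteq> 0 \<or> red f i \<noteq> 0} = {0..<3}"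
    by (intro set_eqI) (simp only: supp mem_Collect_eq atLeast0LessThan lessThan_iff)
  then have weight: "qweight N zero (red f) = 3" by (simp add: qweight_def)
  \<comment> \<open>As \<open>p \<ge> 3\<close>, positions 0, 1 and 2 differ only in the lowest
    digit, so the second difference vanishes.\<close>
  have aff: "y 0 - 2 * y 1 + y 2 = 0" if "digit_affine p y" for y
    using that p3 unfolding digit_affine_def by (auto simp: power2_eq_square div_mult2_eq)
  have comm1: "commutes zero (red f)"
    unfolding commutes_iff
  proof (intro allI impI)
    fix j
    have "[(\<Sum>i<N. rowZ j i * int (zero i) - int (red f i) * rowX j i)
        = (\<Sum>i<N. rowZ j i * 0 - f i * rowX j i)] (mod int p)"
      by (intro cong_sum cong_diff cong_mult cong_refl cong_red) (auto simp: zero_eq)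
    also have "(\<Sum>i<N. rowZ j i * 0 - f i * rowX j i) = 0"
      using f[of "rowX j"] aff[OF digit_affine_rowX] by (simp add: sum_negf)
    finally show "int p dvd (\<Sum>i<N. rowZ j i * int (zero i) - int (red f i) * rowX j i)"
      by (simp add: cong_0_iff)
  qed
  have comm2: "commutes (red h) zero"
    unfolding commutes_iff
  proof (intro allI impI)
    fix j
    have "[(\<Sum>i<N. rowZ j i * int (red h i) - int (zero i) * rowX j i)
        = (\<Sum>i<N. rowZ j i * h i - 0 * rowX j i)] (mod int p)"
      by (intro cong_sum cong_diff cong_mult cong_refl cong_red) (auto simp: zero_eq)
    moreover have "int p dvd (\<Sum>i<N. rowZ j i * h i - 0 * rowX j i)"
      using dvd_sum_digit_affine(2)[OF prime odd_p p_dvd _ digit_affine_rowZ digit_affine_rowZ, of j]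
        nine_dvd by (simp add: h_def)
    ultimately show "int p dvd (\<Sum>i<N. rowZ j i * int (red h i) - int (zero i) * rowX j i)"
      using cong_dvd_iff by blast
  qed
  \<comment> \<open>The second difference of 0, 1, 4 is 2.\<close>
  have "[dot (red f) (red h) = 2] (mod int p)"
    using dot_red_red[of f h] p3 unfolding f by (simp add: h_def)
  then have anti: "\<not> int p dvd dot (red f) (red h) - dot zero zero"
    using np cong_dvd_iff by auto
  show "\<exists>Q. pure_qcode p N (N - n - 2) 3 Q"
    using pure_qcode_code[OF card_G commutes_small_weight, of 3 zero "red f" "red h" zero]
      weight comm1 comm2 anti by auto
  show "n + 2 \<le> N" by (rule is_qcode_code(1)[OF card_G])
qed

end

section \<open>Existence, the Hamming bound and the two lengths\<close>

lemma ex_pure_qcode_3: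
  assumes "prime p" "odd p" "n \<ge> 3" "p ^ (n - 2) \<le> N" "N \<le> p ^ n" "n = 3 \<Longrightarrow> p < N"
    "p dvd N" "p = 3 \<Longrightarrow> 9 dvd N"
  shows "(\<exists>Q. pure_qcode p N (N - n - 2) 3 Q) \<and> n + 2 \<le> N"
proof -
  obtain g where "\<And>c. \<not> int p dvd c ^ n - c - g"
    using ex_rootless_trinomial[of p n] assms prime_gt_1_nat by auto
  then interpret digit_code p N n g using assms by unfold_locales
  from pure_qcode length_ge show ?thesis ..
qed

text \<open>The term \<open>j = 2\<close> alone exceeds \<open>p ^ (n + 2)\<close>:
  \<open>N - 1 \<ge> 3\<close> bounds the binomial below by 3/2 times \<open>p ^ (n - 2)\<close>,
  the square is at least 64/81 times \<open>p ^ 4\<close>, and the product of the two constants is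
  32/27.\<close>

lemma not_quantum_hamming_bound_5:
  assumes p: "p \<ge> 3" and n: "n \<ge> 2" "n + 2 \<le> N" and N: "p ^ (n - 2) \<le> N"
  shows "\<not> quantum_hamming_bound p N (N - n - 2) 5"
proof
  assume "quantum_hamming_bound p N (N - n - 2) 5"
  then have "(\<Sum>j\<le>2. (N choose j) * (p\<^sup>2 - 1) ^ j) \<le> p ^ (n + 2)"
    using n by (simp add: quantum_hamming_bound_def)
  moreover have "{..2} = {0, 1, 2::nat}" by auto
  ultimately have le: "(N choose 2) * (p\<^sup>2 - 1)\<^sup>2 < p ^ (n + 2)" by simp
  \<comment> \<open>The ratio of \<open>p\<^sup>2 - 1\<close> to \<open>p\<^sup>2\<close> is
    smallest at \<open>p = 3\<close>, where it is 8/9.\<close>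
  have "3 * 3 \<le> p * p" using p by (intro mult_mono) auto
  then have "8 * p\<^sup>2 \<le> 9 * (p\<^sup>2 - 1)" by (simp add: power2_eq_square)
  then have "(8 * p\<^sup>2)\<^sup>2 \<le> (9 * (p\<^sup>2 - 1))\<^sup>2" by (rule power_mono) simp
  then have 1: "64 * p ^ 4 \<le> 81 * (p\<^sup>2 - 1)\<^sup>2" by (simp add: power_mult_distrib flip: power_mult)
  have "even (N * (N - 1))" by (cases N) auto
  then have "2 * (N choose 2) = N * (N - 1)" by (simp add: choose_two)
  moreover have "N * 3 \<le> N * (N - 1)" using n by (intro mult_mono) auto
  moreover have "3 * p ^ (n - 2) \<le> N * 3" using N by simp
  ultimately have "3 * p ^ (n - 2) \<le> 2 * (N choose 2)" by linarith
  then have "(3 * p ^ (n - 2)) * (64 * p ^ 4) \<le> (2 * (N choose 2)) * (81 * (p\<^sup>2 - 1)\<^sup>2)"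
    by (rule mult_mono[OF _ 1]) auto
  also have "\<dots> = 162 * ((N choose 2) * (p\<^sup>2 - 1)\<^sup>2)" by simp
  also have "\<dots> \<le> 162 * p ^ (n + 2)" using le by simp
  also have "p ^ (n + 2) = p ^ (n - 2) * p ^ 4" using n by (simp flip: power_add)
  finally show False using p by simp
qed

lemma code_and_bound:
  assumes "prime p" "odd p" "n \<ge> 3" "p ^ (n - 2) \<le> N" "N \<le> p ^ n" "n = 3 \<Longrightarrow> p < N"
    "p dvd N" "p = 3 \<Longrightarrow> 9 dvd N"
  shows "(\<exists>Q. pure_qcode p N (N - n - 2) 3 Q) \<and> at_least_almost_optimal_QHB p N (N - n - 2) 3"
proof -
  have "p \<ge> 3" using assms prime_ge_2_nat[of p] by (cases "p = 2") auto
  with ex_pure_qcode_3[OF assms] not_quantum_hamming_bound_5[of p n N] assms show ?thesis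
    by (simp add: at_least_almost_optimal_QHB_def)
qed

theorem theorem9:
  fixes p n s :: nat and \<epsilon>\<^sub>0 :: int
  assumes "prime p" and "odd p" and "\<epsilon>\<^sub>0 \<in> {1, -1}" and "p = 3 \<longrightarrow> s \<ge> 1"
  shows "(n = 4 + s \<longrightarrow>
           (let N = nat ((int p ^ (n - 1) - \<epsilon>\<^sub>0 * int p ^ (n - 3)) div 2); K = N - n - 2 in
             (\<exists>Q. pure_qcode p N K 3 Q) \<and> at_least_almost_optimal_QHB p N K 3))
       \<and> (n = 3 + s \<longrightarrow>
           (let N = nat ((int p ^ (n - 1) + \<epsilon>\<^sub>0 * int p ^ (n - 2)) div 2); K = N - n - 2 in
             (\<exists>Q. pure_qcode p N K 3 Q) \<and> at_least_almost_optimal_QHB p N K 3))"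
proof -
  have p3: "p \<ge> 3" using assms prime_ge_2_nat[of p] by (cases "p = 2") auto
  have p5: "p \<ge> 5" if "p \<noteq> 3"
    using that p3 assms(2) by (cases "p = 4") auto
  obtain q where q: "p = 2 * q + 1" using assms(2) by (auto elim: oddE)
  have q1: "q \<ge> 1" using q p3 by simp
  have eps: "- 1 \<le> \<epsilon>\<^sub>0" "\<epsilon>\<^sub>0 \<le> 1" using assms(3) by auto
  \<comment> \<open>\<open>t\<close> is half of \<open>p + \<epsilon>\<^sub>0\<close> and
    \<open>t'\<close> half of \<open>p\<^sup>2 - \<epsilon>\<^sub>0\<close>, split so that each
    division is exact. They are the cofactors of \<open>p ^ Suc s\<close> in the lengths for
    \<open>n = 3 + s\<close> and \<open>n = 4 + s\<close>.\<close>
  define t where "t = nat ((int p - 1) div 2 + (1 + \<epsilon>\<^sub>0) div 2)"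
  define t' where "t' = nat (((int p)\<^sup>2 - 1) div 2 + (1 - \<epsilon>\<^sub>0) div 2)"
  have t: "2 * int t = int p + \<epsilon>\<^sub>0" using assms(3) by (auto simp: t_def q)
  have t': "2 * int t' = (int p)\<^sup>2 - \<epsilon>\<^sub>0"
    using assms(3) by (auto simp: t'_def q power2_eq_square algebra_simps)
  \<comment> \<open>For \<open>p = 3\<close> the condition \<open>s \<ge> 1\<close> makes the
    exponent \<open>Suc s\<close> at least 2.\<close>
  have nine: "9 dvd p ^ k * u" if "p = 3" "k \<ge> 2" for k u
    using le_imp_power_dvd[OF that(2), of "3::nat"] that by simp
  have main: "(\<exists>Q. pure_qcode p N (N - n - 2) 3 Q) \<and> at_least_almost_optimal_QHB p N (N - n - 2) 3"
    if "N = p ^ k * u" "k \<ge> 1" "p = 3 \<Longrightarrow> k \<ge> 2" "n \<ge> 3" "p ^ (n - 2) \<le> N" "N \<le> p ^ n" "n = 3 \<Longrightarrow> p < N" for N k u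
    using that assms nine by (intro code_and_bound) (auto intro: dvd_mult2)
  show ?thesis
  proof (intro conjI impI)
    assume n: "n = 4 + s"
    let ?N = "p ^ Suc s * t'"
    have "int p ^ (n - 1) - \<epsilon>\<^sub>0 * int p ^ (n - 3) = 2 * int ?N"
    proof -
      have "2 * int ?N = int p ^ Suc s * (2 * int t')" by simp
      also have "\<dots> = int p ^ (n - 1) - \<epsilon>\<^sub>0 * int p ^ (n - 3)"
        unfolding t' n by (simp add: algebra_simps power2_eq_square power_add eval_nat_numeral)
      finally show ?thesis by simp
    qed
    then have N: "nat ((int p ^ (n - 1) - \<epsilon>\<^sub>0 * int p ^ (n - 3)) div 2) = ?N"
      by (simp only: nonzero_mult_div_cancel_left nat_int)
    have sq: "3 * int p \<le> (int p)\<^sup>2"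
      unfolding power2_eq_square using p3 by (intro mult_right_mono) auto
    have "2 * int p \<le> 2 * int t'" using t' sq p3 eps by linarith
    then have lower: "p \<le> t'" by simp
    have "int t' \<le> (int p)\<^sup>2" using t' sq p3 eps by linarith
    then have upper: "t' \<le> p\<^sup>2" by (simp flip: of_nat_power)
    have "p ^ (n - 2) = p ^ Suc s * p" by (simp add: n)
    also have "\<dots> \<le> ?N" using lower by (intro mult_left_mono) auto
    finally have l: "p ^ (n - 2) \<le> ?N" .
    have "?N \<le> p ^ Suc s * p\<^sup>2" using upper by (intro mult_left_mono) auto
    also have "\<dots> = p ^ (n - 1)" by (simp add: n power_add eval_nat_numeral)
    also have "\<dots> \<le> p ^ n" using p3 by (intro power_increasing) auto
    finally have u: "?N \<le> p ^ n" .
    show "let N = nat ((int p ^ (n - 1) - \<epsilon>\<^sub>0 * int p ^ (n - 3)) div 2); K = N - n - 2 in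
             (\<exists>Q. pure_qcode p N K 3 Q) \<and> at_least_almost_optimal_QHB p N K 3"
      unfolding N Let_def by (rule main[OF refl _ _ _ l u]) (use n assms(4) in auto)
  next
    assume n: "n = 3 + s"
    let ?N = "p ^ Suc s * t"
    have "int p ^ (n - 1) + \<epsilon>\<^sub>0 * int p ^ (n - 2) = 2 * int ?N"
    proof -
      have "2 * int ?N = int p ^ Suc s * (2 * int t)" by simp
      also have "\<dots> = int p ^ (n - 1) + \<epsilon>\<^sub>0 * int p ^ (n - 2)"
        unfolding t n by (simp add: algebra_simps eval_nat_numeral)
      finally show ?thesis by simp
    qed
    then have N: "nat ((int p ^ (n - 1) + \<epsilon>\<^sub>0 * int p ^ (n - 2)) div 2) = ?N"
      by (simp only: nonzero_mult_div_cancel_left nat_int)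
    have lower: "1 \<le> t" and upper: "t \<le> p" using t assms(3) p3 by auto
    have "p ^ (n - 2) = p ^ Suc s" by (simp add: n)
    also have "\<dots> \<le> ?N" using lower by simp
    finally have l: "p ^ (n - 2) \<le> ?N" .
    have "?N \<le> p ^ Suc s * p" using upper by (intro mult_left_mono) auto
    also have "\<dots> = p ^ (n - 1)" by (simp add: n)
    also have "\<dots> \<le> p ^ n" using p3 by (intro power_increasing) auto
    finally have u: "?N \<le> p ^ n" .
    \<comment> \<open>Here \<open>s = 0\<close>, so \<open>p \<ge> 5\<close> and
      \<open>t \<ge> 2\<close>, which puts the length \<open>p * t\<close> strictly above
      \<open>p\<close>.\<close>
    have 3: "p < ?N" if "n = 3"
    proof -
      have "p \<noteq> 3" using assms(4) n that by auto
      then have "t > 1" using p5 t assms(3) by auto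
      then show ?thesis using that n p3 by simp
    qed
    show "let N = nat ((int p ^ (n - 1) + \<epsilon>\<^sub>0 * int p ^ (n - 2)) div 2); K = N - n - 2 in
             (\<exists>Q. pure_qcode p N K 3 Q) \<and> at_least_almost_optimal_QHB p N K 3"
      unfolding N Let_def by (rule main[OF refl _ _ _ l u 3]) (use n assms(4) in auto)
  qed
qed

end
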